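(* Let $\Omega\subseteq\mathbb{H}$ be a hinged domain and let $f:\Omega\to\mathbb{H}$ be a slice regular function. Then there exists a unique slice regular function $\widetilde f:\widetilde\Omega\to\mathbb{H}$ that extends $f$ to the symmetric completion $\widetilde\Omega$ of its domain $\Omega$.
   Context: Basic notation. $\mathbb{H}$ is the algebra of quaternions (Euclidean topology), $\mathbb{S}=\{w\in\mathbb{H}: w^2=-1\}$. For $I\in\mathbb{S}$: $\mathbb{C}_I=\mathbb{R}+\mathbb{R}I$, $\mathbb{C}_I^{\geqslant}=\{\alpha+\beta I:\alpha,\beta\in\mathbb{R},\beta\ge0\}$. For $T\subseteq\mathbb{H}$: $T_I=T\cap\mathbb{C}_I$, $T_I^{\geqslant}=T\cap\mathbb{C}_I^{\geqslant}$. For $x=\alpha+\beta I$ ($\alpha,\beta\in\mathbb{R}$, $I\in\mathbb{S}$), $\mathbb{S}_x=\alpha+\beta\mathbb{S}$. The symmetric completion of $T\subseteq\mathbb{H}$ is $\widetilde T=\bigcup_{x\in T}\mathbb{S}_x$. A domain is a nonempty connected open subset of $\mathbb{H}$. A function $f:\Omega\to\mathbb{H}$ on a domain is slice regular if for every $I\in\mathbb{S}$ the restriction $f_{|\Omega_I}$ is $C^1$ and $\left(\frac{\partial}{\partial\alpha}+I\frac{\partial}{\partial\beta}\right)f(\alpha+\beta I)=0$ on $\Omega_I$; a function on an open set is slice regular if its restriction to each connected component is. An open $U\subseteq\mathbb{H}$ is speared if, for all $I\in\mathbb{S}$, each connected component of $U_I^{\geqslant}$ includes a real point. A speared domain is a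 domain that is a speared open set. Hinged points. Let $\Omega$ be a speared domain. Let $\mathbb{R}_{\mathbb{C}}=\mathbb{R}+\imath\mathbb{R}$ be a copy of the complex plane, with $\phi_J:\mathbb{R}_{\mathbb{C}}\to\mathbb{C}_J$, $\alpha+\imath\beta\mapsto\alpha+\beta J$, and for $J,K\in\mathbb{S}$ set $E^{J,K}=\phi_J^{-1}(\Omega_J^{\geqslant})\cap\phi_K^{-1}(\Omega_K^{\geqslant})$. Let $x_0=\alpha+\beta J_0$, $x_1=\alpha+\beta J_1$, $y_0=\alpha'+\beta'J_0$, $y_1=\alpha'+\beta'J_1$ be points of $\Omega$, with $\beta,\beta'\geq0$, $J_0,J_1\in\mathbb{S}$. We say $(x_1,y_1)$ shadows $(x_0,y_0)$ in $\Omega$ if there is a path $\gamma:[0,1]\to E^{J_0,J_1}$ with $\gamma(0)=\alpha+\beta\imath$, $\gamma(1)=\alpha'+\beta'\imath$. We say $x_1$ is strongly hinged to $x_0$ in $\Omega$ if there is $y\in\Omega\cap\mathbb{R}$ such that $(x_1,y)$ shadows $(x_0,y)$. Let $t\ge1$ be an integer, $T=\{0,\dots,t\}$ and $\{x_s\}_{s=0}^t$ a finite sequence in $\Omega$. For $s,s'\in T$ with $|s-s'|=1$, there is a simple step at $s_0=\min\{s,s'\}$ if (1) $x_{s'}$ belongs to the connected component of $\mathbb{S}_{x_s}\cap\Omega$ that includes $x_s$; or (2) $x_{s'}$ is strongly hinged to $x_s$. If (1) and (2) are false but (3) there exist $s'',s'''\in T\setminus\{s,s'\}$ with $s''-s'''=s'-s$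 such that $(x_{s''},x_{s'''})$ shadows $(x_s,x_{s'})$, then, with $\underline{s}=\min\{s,s',s'',s'''\}$ and $\overline{s}=\max\{s,s',s'',s'''\}-1$, there is a double step at $(\underline{s},\overline{s})$. The sequence is a chain of length $t$ connecting $x_0$ and $x_t$ if, after erasing from $T$ the index $t$ and all indices where a simple step happens, there remains an even number $2\ell$ of indices, which can be listed as $\underline{s}_1,\overline{s}_1,\ldots,\underline{s}_\ell,\overline{s}_\ell$ so that for all $m,n\in\{1,\dots,\ell\}$: a double step happens at $(\underline{s}_m,\overline{s}_m)$ (whence $\underline{s}_m<\overline{s}_m$); $\underline{s}_1<\ldots<\underline{s}_\ell$; and if $m<n$ then either $\overline{s}_m<\underline{s}_n$ or $\overline{s}_m>\overline{s}_n$. For $x,x'\in\Omega$, $x'$ is hinged to $x$ in $\Omega$, written $x\sim x'$, if there is a chain connecting $x$ and $x'$. A speared domain $\Omega$ is a hinged domain if, for each $x\in\Omega$, $x\sim x'$ for all $x'\in\mathbb{S}_x\cap\Omega$. *)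

theory Defs
  imports "HOL-Analysis.Analysis"
begin

section \<open>The quaternions as a Euclidean real normed division algebra\<close>

codatatype quat = Quat (qre: real) (qi: real) (qj: real) (qk: real)

lemma quat_eqI [intro?]:
  "qre x = qre y \<Longrightarrow> qi x = qi y \<Longrightarrow> qj x = qj y \<Longrightarrow> qk x = qk y \<Longrightarrow> x = y"
  by (rule quat.expand) simp

lemma quat_eq_iff:
  "x = y \<longleftrightarrow> qre x = qre y \<and> qi x = qi y \<and> qj x = qj y \<and> qk x = qk y"
  by (auto intro: quat.expand)

instantiation quat :: ab_group_add
begin

primcorec zero_quat where
  "qre 0 = 0" | "qi 0 = 0" | "qj 0 = 0" | "qk 0 = 0"

primcorec plus_quat where
  "qre (x + y) = qre x + qre y"
| "qi (x + y) = qi x + qi y"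
| "qj (x + y) = qj x + qj y"
| "qk (x + y) = qk x + qk y"

primcorec uminus_quat where
  "qre (- x) = - qre x"
| "qi (- x) = - qi x"
| "qj (- x) = - qj x"
| "qk (- x) = - qk x"

primcorec minus_quat where
  "qre (x - y) = qre x - qre y"
| "qi (x - y) = qi x - qi y"
| "qj (x - y) = qj x - qj y"
| "qk (x - y) = qk x - qk y"

instance
  by standard (simp_all add: quat_eq_iff)

end

instantiation quat :: real_vector
begin

primcorec scaleR_quat where
  "qre (scaleR r x) = r * qre x"
| "qi (scaleR r x) = r * qi x"
| "qj (scaleR r x) = r * qj x"
| "qk (scaleR r x) = r * qk x"

instance
  by standard (simp_all add: quat_eq_iff algebra_simps)

end

instantiation quat :: real_algebra_1
begin

primcorec one_quat where
  "qre 1 = 1" | "qi 1 = 0" | "qj 1 = 0" | "qk 1 = 0"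

primcorec times_quat where
  "qre (x * y) = qre x * qre y - qi x * qi y - qj x * qj y - qk x * qk y"
| "qi (x * y) = qre x * qi y + qi x * qre y + qj x * qk y - qk x * qj y"
| "qj (x * y) = qre x * qj y - qi x * qk y + qj x * qre y + qk x * qi y"
| "qk (x * y) = qre x * qk y + qi x * qj y - qj x * qi y + qk x * qre y"

instance
  by standard (simp_all add: quat_eq_iff algebra_simps)

end

instantiation quat :: real_inner
begin

definition inner_quat_def:
  "inner x y = qre x * qre y + qi x * qi y + qj x * qj y + qk x * qk y" for x y :: quat

definition norm_quat_def: "norm x = sqrt (inner x x)" for x :: quat

definition sgn_quat_def: "sgn x = x /\<^sub>R norm x" for x :: quat

definition dist_quat_def: "dist x y = norm (x - y)" for x y :: quat

definition uniformity_quat_def [code del]: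
  "(uniformity :: (quat \<times> quat) filter) = (INF e\<in>{0 <..}. principal {(x, y). dist x y < e})"

definition open_quat_def [code del]:
  "open (U :: quat set) \<longleftrightarrow> (\<forall>x\<in>U. eventually (\<lambda>(x', y). x' = x \<longrightarrow> y \<in> U) uniformity)"

instance
proof
  fix x y z :: quat and r :: real
  show "inner x y = inner y x" "inner (x + y) z = inner x z + inner y z"
    "inner (scaleR r x) y = r * inner x y"
    by (simp_all add: inner_quat_def algebra_simps)
  show "0 \<le> inner x x"
    by (simp add: inner_quat_def)
  show "inner x x = 0 \<longleftrightarrow> x = 0"
    by (simp add: inner_quat_def quat_eq_iff add_nonneg_eq_0_iff)
qed (rule norm_quat_def sgn_quat_def dist_quat_def open_quat_def uniformity_quat_def)+

end

lemma norm_quat_square: "(norm x)\<^sup>2 = (qre x)\<^sup>2 + (qi x)\<^sup>2 + (qj x)\<^sup>2 + (qk x)\<^sup>2"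
  unfolding norm_quat_def by (simp add: inner_quat_def power2_eq_square)

instantiation quat :: real_normed_div_algebra
begin

text \<open>The inverse is the conjugate divided by the squared norm.\<close>

definition inverse_quat_def:
  "inverse x = Quat (qre x) (- qi x) (- qj x) (- qk x) /\<^sub>R (norm x)\<^sup>2" for x :: quat

definition divide_quat_def: "x div y = x * inverse y" for x y :: quat

instance
proof
  fix x y :: quat
  show "inverse 0 = (0 :: quat)"
    by (simp add: inverse_quat_def)
  show "x div y = x * inverse y"
    by (rule divide_quat_def)
  show "norm (x * y) = norm x * norm y"
  proof (rule power2_eq_imp_eq)
    show "(norm (x * y))\<^sup>2 = (norm x * norm y)\<^sup>2"
      unfolding power_mult_distrib norm_quat_square times_quat.sel
      by (simp only: power2_eq_square) (simp add: algebra_simps)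
  qed simp_all
  assume "x \<noteq> 0"
  then have n: "(norm x)\<^sup>2 \<noteq> 0" by simp
  have "x * Quat (qre x) (- qi x) (- qj x) (- qk x) = (norm x)\<^sup>2 *\<^sub>R 1"
    "Quat (qre x) (- qi x) (- qj x) (- qk x) * x = (norm x)\<^sup>2 *\<^sub>R 1"
    unfolding norm_quat_square by (simp_all add: quat_eq_iff power2_eq_square algebra_simps)
  with n show "inverse x * x = 1" "x * inverse x = 1"
    by (simp_all add: inverse_quat_def)
qed

end

instantiation quat :: euclidean_space
begin

definition Basis_quat_def: "Basis = {Quat 1 0 0 0, Quat 0 1 0 0, Quat 0 0 1 0, Quat 0 0 0 1}"

instance
proof
  show "u \<in> Basis \<Longrightarrow> v \<in> Basis \<Longrightarrow> inner u v = (if u = v then 1 else 0)" for u v :: quat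
    unfolding Basis_quat_def insert_iff empty_iff
    by (elim disjE) (simp_all add: inner_quat_def)
  show "(\<forall>u\<in>Basis. inner x u = 0) \<longleftrightarrow> x = 0" for x :: quat
    unfolding Basis_quat_def ball_simps inner_quat_def quat_eq_iff by simp
qed (simp_all add: Basis_quat_def)

end


section \<open>Slices and symmetric completion\<close>

definition imag_units :: "quat set" where
  "imag_units = {w. w\<^sup>2 = -1}"

text \<open>
  The map \<open>\<alpha> + \<i>\<beta> \<mapsto> \<alpha> + \<beta> J\<close>; the type \<^typ>\<open>complex\<close> plays the role of the abstract
  copy of the complex plane.
\<close>

definition slice_map :: "quat \<Rightarrow> complex \<Rightarrow> quat" where
  "slice_map J z = of_real (Re z) + Im z *\<^sub>R J"

definition half_slice :: "quat \<Rightarrow> quat set" where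
  "half_slice J = {slice_map J z | z. Im z \<ge> 0}"

text \<open>
  The set \<open>\<alpha> + \<beta>\<S>\<close> for \<open>x = \<alpha> + \<beta> I\<close>. It is a 2-sphere if \<open>x\<close> is not real, and \<open>{x}\<close> if \<open>x\<close> is
  real; it does not depend on the representation of \<open>x\<close>.
\<close>

definition conj_sphere :: "quat \<Rightarrow> quat set" where
  "conj_sphere x =
    {slice_map J z | J z. J \<in> imag_units \<and> (\<exists>I\<in>imag_units. x = slice_map I z)}"

definition symmetric_completion :: "quat set \<Rightarrow> quat set" where
  "symmetric_completion T = (\<Union>x\<in>T. conj_sphere x)"


section \<open>Slice regular functions\<close>

definition quat_domain :: "quat set \<Rightarrow> bool" where
  "quat_domain D \<longleftrightarrow> D \<noteq> {} \<and> connected D \<and> open D"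

definition C1_on ::
    "('a::real_normed_vector \<Rightarrow> 'b::real_normed_vector) \<Rightarrow> 'a set \<Rightarrow> bool" where
  "C1_on F U \<longleftrightarrow> (\<exists>F' :: 'a \<Rightarrow> 'a \<Rightarrow>\<^sub>L 'b.
     (\<forall>z\<in>U. (F has_derivative blinfun_apply (F' z)) (at z)) \<and> continuous_on U F')"

text \<open>
  A function on \<open>D\<close> is represented by a total function, of which only the values on \<open>D\<close> matter:
  the preimage of \<open>D\<close> under \<^term>\<open>slice_map I\<close> is open, so the derivatives below only depend on
  these values.
\<close>

definition slice_regular_on_domain :: "(quat \<Rightarrow> quat) \<Rightarrow> quat set \<Rightarrow> bool" where
  "slice_regular_on_domain f D \<longleftrightarrow> quat_domain D \<and>
    (\<forall>I\<in>imag_units.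
       C1_on (f \<circ> slice_map I) (slice_map I -` D) \<and>
       (\<forall>\<alpha> \<beta>. slice_map I (Complex \<alpha> \<beta>) \<in> D \<longrightarrow>
          vector_derivative (\<lambda>a. f (slice_map I (Complex a \<beta>))) (at \<alpha>)
          + I * vector_derivative (\<lambda>b. f (slice_map I (Complex \<alpha> b))) (at \<beta>) = 0))"

definition slice_regular_on :: "(quat \<Rightarrow> quat) \<Rightarrow> quat set \<Rightarrow> bool" where
  "slice_regular_on f U \<longleftrightarrow> open U \<and> (\<forall>C\<in>components U. slice_regular_on_domain f C)"


section \<open>Speared domains and hinged points\<close>

definition speared :: "quat set \<Rightarrow> bool" where
  "speared U \<longleftrightarrow> open U \<and>
    (\<forall>I\<in>imag_units. \<forall>C\<in>components (U \<inter> half_slice I). C \<inter> \<real> \<noteq> {})"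

definition speared_domain :: "quat set \<Rightarrow> bool" where
  "speared_domain D \<longleftrightarrow> quat_domain D \<and> speared D"

definition common_half_slice :: "quat set \<Rightarrow> quat \<Rightarrow> quat \<Rightarrow> complex set" where
  "common_half_slice D J K =
    slice_map J -` (D \<inter> half_slice J) \<inter> slice_map K -` (D \<inter> half_slice K)"

text \<open>
  \<open>shadows D x\<^sub>1 y\<^sub>1 x\<^sub>0 y\<^sub>0\<close>: the pair \<open>(x\<^sub>1, y\<^sub>1)\<close> shadows the pair \<open>(x\<^sub>0, y\<^sub>0)\<close> in \<open>D\<close>.
  The units \<open>J\<^sub>0\<close>, \<open>J\<^sub>1\<close> are determined by the points unless \<open>x\<^sub>0\<close> and \<open>y\<^sub>0\<close> are both real, in
  which case any choice is allowed.
\<close>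

definition shadows :: "quat set \<Rightarrow> quat \<Rightarrow> quat \<Rightarrow> quat \<Rightarrow> quat \<Rightarrow> bool" where
  "shadows D x1 y1 x0 y0 \<longleftrightarrow>
    (\<exists>z w J0 J1. Im z \<ge> 0 \<and> Im w \<ge> 0 \<and> J0 \<in> imag_units \<and> J1 \<in> imag_units \<and>
       x0 = slice_map J0 z \<and> x1 = slice_map J1 z \<and>
       y0 = slice_map J0 w \<and> y1 = slice_map J1 w \<and>
       x0 \<in> D \<and> x1 \<in> D \<and> y0 \<in> D \<and> y1 \<in> D \<and>
       (\<exists>\<gamma>. path \<gamma> \<and> path_image \<gamma> \<subseteq> common_half_slice D J0 J1 \<and>
            pathstart \<gamma> = z \<and> pathfinish \<gamma> = w))"

definition strongly_hinged :: "quat set \<Rightarrow> quat \<Rightarrow> quat \<Rightarrow> bool" where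
  "strongly_hinged D x1 x0 \<longleftrightarrow> (\<exists>y\<in>D \<inter> \<real>. shadows D x1 y x0 y)"

text \<open>
  A sequence \<open>x\<^sub>0, \<dots>, x\<^sub>t\<close> is a function on \<^typ>\<open>nat\<close>, of which only the values on \<open>{0..t}\<close> matter.
\<close>

definition simple_pair :: "quat set \<Rightarrow> (nat \<Rightarrow> quat) \<Rightarrow> nat \<Rightarrow> nat \<Rightarrow> bool" where
  "simple_pair D x s s' \<longleftrightarrow>
    x s' \<in> connected_component_set (conj_sphere (x s) \<inter> D) (x s) \<or>
    strongly_hinged D (x s') (x s)"

definition simple_step :: "quat set \<Rightarrow> nat \<Rightarrow> (nat \<Rightarrow> quat) \<Rightarrow> nat \<Rightarrow> bool" where
  "simple_step D t x s0 \<longleftrightarrow>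
    (\<exists>s\<in>{0..t}. \<exists>s'\<in>{0..t}. \<bar>int s - int s'\<bar> = 1 \<and> s0 = min s s' \<and> simple_pair D x s s')"

definition double_step ::
    "quat set \<Rightarrow> nat \<Rightarrow> (nat \<Rightarrow> quat) \<Rightarrow> nat \<Rightarrow> nat \<Rightarrow> bool" where
  "double_step D t x p q \<longleftrightarrow>
    (\<exists>s\<in>{0..t}. \<exists>s'\<in>{0..t}. \<bar>int s - int s'\<bar> = 1 \<and> \<not> simple_pair D x s s' \<and>
      (\<exists>s2\<in>{0..t} - {s, s'}. \<exists>s3\<in>{0..t} - {s, s'}.
         int s2 - int s3 = int s' - int s \<and>
         shadows D (x s2) (x s3) (x s) (x s') \<and>
         p = Min {s, s', s2, s3} \<and> q = Max {s, s', s2, s3} - 1))"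

text \<open>
  Since \<open>R\<close> has \<open>2 l\<close> elements, the condition \<open>R = p ` {1..l} \<union> q ` {1..l}\<close> says that
  \<open>p\<^sub>1, q\<^sub>1, \<dots>, p\<^sub>l, q\<^sub>l\<close> lists the elements of \<open>R\<close> without repetitions.
\<close>

definition chain_in :: "quat set \<Rightarrow> nat \<Rightarrow> (nat \<Rightarrow> quat) \<Rightarrow> bool" where
  "chain_in D t x \<longleftrightarrow> t \<ge> 1 \<and> (\<forall>s\<in>{0..t}. x s \<in> D) \<and>
    (let R = {0..t} - {t} - {s. simple_step D t x s} in
      \<exists>l p q. card R = 2 * l \<and> R = p ` {1..l} \<union> q ` {1..l} \<and>
        (\<forall>m\<in>{1..l}. double_step D t x (p m) (q m)) \<and>
        (\<forall>m\<in>{1..l}. \<forall>n\<in>{1..l}. m < n \<longrightarrow> p m < p n \<and> (q m < p n \<or> q m > q n)))"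

definition hinged :: "quat set \<Rightarrow> quat \<Rightarrow> quat \<Rightarrow> bool" where
  "hinged D x x' \<longleftrightarrow> (\<exists>t \<xi>. chain_in D t \<xi> \<and> \<xi> 0 = x \<and> \<xi> t = x')"

definition hinged_domain :: "quat set \<Rightarrow> bool" where
  "hinged_domain D \<longleftrightarrow> speared_domain D \<and>
    (\<forall>x\<in>D. \<forall>x'\<in>conj_sphere x \<inter> D. hinged D x x')"

end

theory Submission
  imports Defs "HOL-Complex_Analysis.Conformal_Mappings"
begin

text \<open>
  Near a point \<open>\<alpha> + \<beta> J\<close> of a speared domain, \<open>f (\<alpha> + \<beta> K) = a (\<alpha>, \<beta>) + K * b (\<alpha>, \<beta>)\<close> for all
  units \<open>K\<close> close to \<open>J\<close>, where the stem \<open>(a, b)\<close> is determined by the restrictions of \<open>f\<close> to any two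
  of these slices: this holds near real points, where all slices meet, and by the identity principle
  it propagates along half slices. By the same principle, if the stems at \<open>J\<close> and \<open>J'\<close> agree over one
  point of a connected subset of the common half slice, they agree over all of it. Hence every step
  of a chain preserves the stem, the double steps being undone from the inside out since they are
  nested. In a hinged domain the stem thus depends on the sphere only, and \<open>a + K * b\<close> for
  arbitrary \<open>K\<close> defines the extension.
\<close>

section \<open>Slice holomorphic functions\<close>

lemma imag_units_iff: "J \<in> imag_units \<longleftrightarrow> qre J = 0 \<and> norm J = 1"
proof -
  have 1: "J \<in> imag_units \<longleftrightarrow> qre (J * J) = -1 \<and> qi (J * J) = 0 \<and> qj (J * J) = 0 \<and> qk (J * J) = 0"
    unfolding imag_units_def mem_Collect_eq power2_eq_square quat_eq_iff by simp
  have 2: "norm J = 1 \<longleftrightarrow> (qre J)\<^sup>2 + (qi J)\<^sup>2 + (qj J)\<^sup>2 + (qk J)\<^sup>2 = 1"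
    using norm_ge_zero[of J] unfolding norm_quat_square[symmetric] power2_eq_1_iff by linarith
  \<comment> \<open>The imaginary components of \<open>J * J\<close> are twice the real part times
    those of \<open>J\<close>. A nonzero real part would thus make \<open>J\<close> real, with
    nonnegative square.\<close>
  have "qre J = 0" if J: "J \<in> imag_units"
  proof (rule ccontr)
    assume "qre J \<noteq> 0"
    with J[unfolded 1] have "qi J = 0" "qj J = 0" "qk J = 0" by simp_all
    with J[unfolded 1] have "qre J * qre J = -1" by simp
    then show False using zero_le_square[of "qre J"] by linarith
  qed
  moreover have "J \<in> imag_units \<longleftrightarrow> norm J = 1" if "qre J = 0"
    unfolding 1 2 using that by (auto simp: power2_eq_square)
  ultimately show ?thesis by blast
qed

lemma imag_unit_square: "J \<in> imag_units \<Longrightarrow> J * J = -1"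
  by (simp add: imag_units_def power2_eq_square)

lemma imag_unit_square_left: "J \<in> imag_units \<Longrightarrow> J * (J * x) = - x"
  by (simp add: imag_unit_square flip: mult.assoc)

lemma uminus_imag_units [simp]: "- J \<in> imag_units \<longleftrightarrow> J \<in> imag_units"
  by (simp add: imag_units_def)

lemma inner_imag_unit_self: "J \<in> imag_units \<Longrightarrow> J \<bullet> J = 1"
  by (simp add: imag_units_iff norm_eq_1)

lemma inner_1_quat [simp]: "1 \<bullet> x = qre x" "x \<bullet> 1 = qre x" for x :: quat
  by (simp_all add: inner_quat_def)

lemma qre_of_real [simp]: "qre (of_real r) = r"
  by (simp add: of_real_def)

lemma bounded_linear_qre: "bounded_linear qre"
  using bounded_linear_inner_right[of "1::quat"] by simp

lemma bounded_linear_slice_map: "bounded_linear (slice_map J)"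
  unfolding slice_map_def
  by (intro bounded_linear_add bounded_linear_compose[OF bounded_linear_of_real bounded_linear_Re]
      bounded_linear_scaleR_const bounded_linear_Im)

lemma continuous_slice_map: "continuous_on U (\<lambda>x. slice_map (j x) (z x))"
  if "continuous_on U j" "continuous_on U z" for j :: "'a::topological_space \<Rightarrow> quat"
  unfolding slice_map_def by (intro continuous_intros that)

lemma open_slice_map_vimage: "open U \<Longrightarrow> open (slice_map J -` U)"
  by (rule open_vimage[OF _ linear_continuous_on[OF bounded_linear_slice_map]])

lemma slice_map_real: "Im z = 0 \<Longrightarrow> slice_map J z = of_real (Re z)"
  by (simp add: slice_map_def)

lemma slice_map_cnj: "slice_map J (cnj z) = slice_map (- J) z"
  by (simp add: slice_map_def)

lemma slice_map_scaleR_mult: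
  "slice_map J z * x = Re z *\<^sub>R x + Im z *\<^sub>R (J * x)"
  by (simp add: slice_map_def algebra_simps of_real_def)

text \<open>For a unit \<open>J\<close>, this is the orthogonal projection onto the plane spanned by
  1 and \<open>J\<close>, read in complex coordinates. It is defined on all quaternions, hence
  continuous everywhere, and inverts \<open>slice_map J\<close> on the left.\<close>

definition slice_coord :: "quat \<Rightarrow> quat \<Rightarrow> complex" where
  "slice_coord J x = Complex (qre x) (x \<bullet> J)"

lemma slice_coord_slice_map:
  assumes "J \<in> imag_units"
  shows "slice_coord J (slice_map J z) = z"
  using assms inner_imag_unit_self[OF assms]
  by (simp add: slice_coord_def slice_map_def imag_units_iff inner_add_left of_real_def
      complex_eq_iff)

lemma continuous_on_slice_coord: "continuous_on U (slice_coord J)"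
  unfolding slice_coord_def Complex_eq
  by (intro continuous_intros bounded_linear.continuous_on[OF bounded_linear_qre])

text \<open>The point of the closed upper half plane that labels the sphere through
  \<open>x\<close>; it serves as a continuous invariant of spheres.\<close>

definition upper_coord :: "quat \<Rightarrow> complex" where
  "upper_coord x = Complex (qre x) (norm (x - of_real (qre x)))"

lemma continuous_on_upper_coord: "continuous_on U upper_coord"
  unfolding upper_coord_def Complex_eq
  by (intro continuous_intros bounded_linear.continuous_on[OF bounded_linear_qre])

lemma upper_coord_slice_map:
  assumes "J \<in> imag_units" "Im z \<ge> 0"
  shows "upper_coord (slice_map J z) = z"
  using assms by (simp add: upper_coord_def slice_map_def imag_units_iff complex_eq_iff)

lemma Im_upper_coord [simp]: "Im (upper_coord x) \<ge> 0"
  by (simp add: upper_coord_def)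

lemma ex_imag_unit: "\<exists>J. J \<in> imag_units"
  by (rule exI[of _ "Quat 0 1 0 0"]) (simp add: imag_units_iff norm_quat_def inner_quat_def)

lemma ex_slice_map_upper_coord: "\<exists>J\<in>imag_units. x = slice_map J (upper_coord x)"
proof (cases "x = of_real (qre x)")
  case True
  obtain J where "J \<in> imag_units" using ex_imag_unit by blast
  then show ?thesis using True
    by (intro bexI[of _ J]) (simp_all add: upper_coord_def slice_map_def)
next
  case False
  then show ?thesis
    by (intro bexI[of _ "sgn (x - of_real (qre x))"])
      (simp_all add: upper_coord_def slice_map_def imag_units_iff sgn_div_norm)
qed

section \<open>Functions holomorphic along one slice\<close>

text \<open>The Cauchy-Riemann equation for \<open>I\<close> says that the derivative commutes with
  left multiplication by \<open>I\<close>, which forces the form \<open>slice_map I w * d\<close>.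
  The continuity of \<open>d\<close> is supplied by
  \<open>slice_holomorphic_derivative_continuous\<close>.\<close>

definition slice_holomorphic_on :: "quat \<Rightarrow> (complex \<Rightarrow> quat) \<Rightarrow> complex set \<Rightarrow> bool" where
  "slice_holomorphic_on I h U \<longleftrightarrow>
    (\<forall>z\<in>U. \<exists>d. (h has_derivative (\<lambda>w. slice_map I w * d)) (at z))"

lemma slice_holomorphic_on_subset:
  "slice_holomorphic_on I h U \<Longrightarrow> V \<subseteq> U \<Longrightarrow> slice_holomorphic_on I h V"
  unfolding slice_holomorphic_on_def by blast

lemma slice_holomorphic_on_cong:
  assumes "slice_holomorphic_on I h U" "open U" "\<And>z. z \<in> U \<Longrightarrow> h z = k z"
  shows "slice_holomorphic_on I k U"
  unfolding slice_holomorphic_on_def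
proof
  fix z assume z: "z \<in> U"
  with assms(1) obtain d where "(h has_derivative (\<lambda>w. slice_map I w * d)) (at z)"
    unfolding slice_holomorphic_on_def by blast
  then have "(k has_derivative (\<lambda>w. slice_map I w * d)) (at z)"
    by (rule has_derivative_transform_within_open[OF _ assms(2) z assms(3)])
  then show "\<exists>d. (k has_derivative (\<lambda>w. slice_map I w * d)) (at z)" ..
qed

lemma slice_holomorphic_on_diff:
  assumes "slice_holomorphic_on I h U" "slice_holomorphic_on I k U"
  shows "slice_holomorphic_on I (\<lambda>z. h z - k z) U"
  unfolding slice_holomorphic_on_def
proof
  fix z assume "z \<in> U"
  with assms obtain d e where
    "(h has_derivative (\<lambda>w. slice_map I w * d)) (at z)"
    "(k has_derivative (\<lambda>w. slice_map I w * e)) (at z)"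
    unfolding slice_holomorphic_on_def by blast
  from has_derivative_diff[OF this]
  have "((\<lambda>z. h z - k z) has_derivative (\<lambda>w. slice_map I w * (d - e))) (at z)"
    by (simp add: algebra_simps)
  then show "\<exists>d. ((\<lambda>z. h z - k z) has_derivative (\<lambda>w. slice_map I w * d)) (at z)" ..
qed

text \<open>
  \<open>complex_part I\<close> intertwines left multiplication by \<open>I\<close> with multiplication by \<open>\<i>\<close>; after right
  multiplication by the four basis elements, these parts determine a quaternion.
\<close>

definition complex_part :: "quat \<Rightarrow> quat \<Rightarrow> complex" where
  "complex_part I x = Complex (qre x) (- qre (I * x))"

lemma bounded_linear_complex_part: "bounded_linear (complex_part I)"
proof -
  have "bounded_linear (\<lambda>x. qre (I * x))"
    by (rule bounded_linear_compose[OF bounded_linear_qre bounded_linear_mult_right])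
  then have "bounded_linear (\<lambda>x. of_real (qre x) + \<i> * of_real (- qre (I * x)))"
    by (intro bounded_linear_add bounded_linear_compose[OF bounded_linear_mult_right]
        bounded_linear_compose[OF bounded_linear_of_real] bounded_linear_minus bounded_linear_qre)
  then show ?thesis unfolding complex_part_def Complex_eq .
qed

lemma complex_part_slice_map:
  assumes "I \<in> imag_units"
  shows "complex_part I (slice_map I w * x) = complex_part I x * w"
  using imag_unit_square_left[OF assms, of x]
  by (simp add: complex_part_def slice_map_scaleR_mult complex_eq_iff algebra_simps
      del: times_quat.sel)

lemma has_field_derivative_complex_part:
  assumes "I \<in> imag_units" "(h has_derivative (\<lambda>w. slice_map I w * d)) (at z)"
  shows "((\<lambda>z. complex_part I (h z * c)) has_field_derivative complex_part I (d * c)) (at z)"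
proof -
  have "((\<lambda>z. complex_part I (h z * c)) has_derivative
      (\<lambda>w. complex_part I ((slice_map I w * d) * c))) (at z)"
    by (rule bounded_linear.has_derivative[OF bounded_linear_complex_part
          bounded_linear.has_derivative[OF bounded_linear_mult_left assms(2)]])
  then show ?thesis
    unfolding has_field_derivative_def
    by (simp add: mult.assoc complex_part_slice_map[OF assms(1)])
qed

lemma slice_holomorphic_imp_holomorphic:
  assumes "I \<in> imag_units" "slice_holomorphic_on I h U"
  shows "(\<lambda>z. complex_part I (h z * c)) holomorphic_on U"
  using assms has_field_derivative_complex_part[OF assms(1)]
  unfolding slice_holomorphic_on_def holomorphic_on_def field_differentiable_def
  by (blast intro: has_field_derivative_at_within)

lemma quat_eq_0_if_complex_parts:
  assumes "\<And>c. complex_part I (x * c) = 0"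
  shows "x = 0"
proof -
  have "qre (x * c) = 0" for c
    using assms[of c] by (simp add: complex_part_def complex_eq_iff del: times_quat.sel)
  from this[of 1] this[of "Quat 0 1 0 0"] this[of "Quat 0 0 1 0"] this[of "Quat 0 0 0 1"]
  show ?thesis by (simp add: quat_eq_iff)
qed

text \<open>Each \<open>complex_part I (h z * c)\<close> is an ordinary holomorphic function, so
  classical analytic continuation applies to it; letting \<open>c\<close> vary recovers
  \<open>h\<close>.\<close>

lemma slice_holomorphic_identity:
  assumes "I \<in> imag_units" "slice_holomorphic_on I h S" "open S" "connected S"
    and "U \<subseteq> S" "\<xi> \<in> S" "\<xi> islimpt U" "\<And>z. z \<in> U \<Longrightarrow> h z = 0" "z \<in> S"
  shows "h z = 0"
proof (rule quat_eq_0_if_complex_parts)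
  fix c
  show "complex_part I (h z * c) = 0"
    by (rule analytic_continuation[OF slice_holomorphic_imp_holomorphic[OF assms(1,2)] assms(3-7)])
      (use assms(8,9) in \<open>simp_all add: complex_part_def complex_eq_iff\<close>)
qed

text \<open>The complex parts of \<open>d z * c\<close> are derivatives of holomorphic functions,
  hence continuous, and their real parts for four values of \<open>c\<close> give the coordinates of
  \<open>d\<close>.\<close>

lemma slice_holomorphic_derivative_continuous:
  assumes I: "I \<in> imag_units" and U: "open U"
    and d: "\<And>z. z \<in> U \<Longrightarrow> (h has_derivative (\<lambda>w. slice_map I w * d z)) (at z)"
  shows "continuous_on U d"
proof -
  have c: "continuous_on U (\<lambda>z. qre (d z * c))" for c
  proof -
    let ?F = "\<lambda>z. complex_part I (h z * c)"
    have F: "(?F has_field_derivative complex_part I (d z * c)) (at z)" if "z \<in> U" for z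
      by (rule has_field_derivative_complex_part[OF I d[OF that]])
    then have "?F holomorphic_on U"
      unfolding holomorphic_on_def field_differentiable_def
      by (blast intro: has_field_derivative_at_within)
    then have "continuous_on U (deriv ?F)"
      by (intro holomorphic_on_imp_continuous_on holomorphic_deriv U)
    then have "continuous_on U (\<lambda>z. Re (deriv ?F z))"
      by (intro continuous_intros)
    then show ?thesis
      by (rule continuous_on_eq) (simp only: DERIV_imp_deriv[OF F], simp add: complex_part_def)
  qed
  \<comment> \<open>Right multiplication by an imaginary basis unit moves the corresponding
    coordinate into the real part with the opposite sign, whence the minus signs.\<close>
  have eq: "d = (\<lambda>z. qre (d z * 1) *\<^sub>R 1 - qre (d z * Quat 0 1 0 0) *\<^sub>R Quat 0 1 0 0
      - qre (d z * Quat 0 0 1 0) *\<^sub>R Quat 0 0 1 0 - qre (d z * Quat 0 0 0 1) *\<^sub>R Quat 0 0 0 1)"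
    by (rule ext) (simp add: quat_eq_iff)
  show ?thesis
    by (subst eq) (intro continuous_intros c)
qed

section \<open>Slice regularity as holomorphy along every slice\<close>

lemma vector_derivatives_Complex:
  fixes h :: "complex \<Rightarrow> quat"
  assumes "(h has_derivative D) (at (Complex \<alpha> \<beta>))"
  shows "vector_derivative (\<lambda>a. h (Complex a \<beta>)) (at \<alpha>) = D 1"
    and "vector_derivative (\<lambda>b. h (Complex \<alpha> b)) (at \<beta>) = D \<i>"
proof -
  interpret D: bounded_linear D using assms by (rule has_derivative_bounded_linear)
  have "((\<lambda>a. h (Complex a \<beta>)) has_derivative (\<lambda>x. D (of_real x))) (at \<alpha>)"
    by (rule has_derivative_compose[of "\<lambda>a. Complex a \<beta>" _ _ _ h])
      (auto simp: Complex_eq assms[unfolded Complex_eq] intro!: derivative_eq_intros)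
  moreover have "(\<lambda>x. D (of_real x)) = (\<lambda>x. x *\<^sub>R D 1)"
    by (simp add: of_real_def D.scaleR)
  ultimately show "vector_derivative (\<lambda>a. h (Complex a \<beta>)) (at \<alpha>) = D 1"
    by (intro vector_derivative_at) (simp add: has_vector_derivative_def)
  have "((\<lambda>b. h (Complex \<alpha> b)) has_derivative (\<lambda>x. D (\<i> * of_real x))) (at \<beta>)"
    by (rule has_derivative_compose[of "\<lambda>b. Complex \<alpha> b" _ _ _ h])
      (auto simp: Complex_eq assms[unfolded Complex_eq] intro!: derivative_eq_intros)
  moreover have "(\<lambda>x. D (\<i> * of_real x)) = (\<lambda>x. x *\<^sub>R D \<i>)"
    by (subst D.scaleR[symmetric]) (simp add: scaleR_conv_of_real mult.commute)
  ultimately show "vector_derivative (\<lambda>b. h (Complex \<alpha> b)) (at \<beta>) = D \<i>"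
    by (intro vector_derivative_at) (simp add: has_vector_derivative_def)
qed

text \<open>Differentiability is local and components of open sets are open, so the conditions on
  the components amount to one condition on \<open>U\<close>. The partial derivatives are
  \<open>D 1\<close> and \<open>D \<i>\<close>, and the Cauchy-Riemann equation fixes the second in
  terms of the first.\<close>

lemma slice_regular_on_iff:
  "slice_regular_on f U \<longleftrightarrow> open U \<and>
    (\<forall>I\<in>imag_units. slice_holomorphic_on I (f \<circ> slice_map I) (slice_map I -` U))"
proof safe
  assume f: "slice_regular_on f U"
  show "open U" using f unfolding slice_regular_on_def by blast
  fix I assume I: "I \<in> imag_units"
  show "slice_holomorphic_on I (f \<circ> slice_map I) (slice_map I -` U)"
    unfolding slice_holomorphic_on_def
  proof
    fix z assume "z \<in> slice_map I -` U"
    then obtain C where C: "C \<in> components U" "slice_map I z \<in> C"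
      by (metis UnionE Union_components vimageD)
    with f I have "C1_on (f \<circ> slice_map I) (slice_map I -` C)"
      and CR: "vector_derivative (\<lambda>a. f (slice_map I (Complex a (Im z)))) (at (Re z))
          + I * vector_derivative (\<lambda>b. f (slice_map I (Complex (Re z) b))) (at (Im z)) = 0"
      unfolding slice_regular_on_def slice_regular_on_domain_def by auto
    then obtain D where D: "((f \<circ> slice_map I) has_derivative D) (at z)"
      using C(2) unfolding C1_on_def by blast
    from D have "((f \<circ> slice_map I) has_derivative D) (at (Complex (Re z) (Im z)))" by simp
    from vector_derivatives_Complex[OF this] CR have "D 1 + I * D \<i> = 0" by simp
    then have "I * (D 1 + I * D \<i>) = 0" by simp
    then have Di: "D \<i> = I * D 1"
      by (simp add: distrib_left imag_unit_square_left[OF I])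
    interpret D: bounded_linear D using D by (rule has_derivative_bounded_linear)
    have "D w = slice_map I w * D 1" for w
    proof -
      have "w = Re w *\<^sub>R 1 + Im w *\<^sub>R \<i>" by (simp add: complex_eq_iff)
      then have "D w = D (Re w *\<^sub>R 1 + Im w *\<^sub>R \<i>)" by (rule arg_cong)
      also have "\<dots> = Re w *\<^sub>R D 1 + Im w *\<^sub>R D \<i>" by (simp only: D.add D.scaleR)
      finally have "D w = Re w *\<^sub>R D 1 + Im w *\<^sub>R D \<i>" .
      then show ?thesis by (simp add: Di slice_map_scaleR_mult)
    qed
    then have "D = (\<lambda>w. slice_map I w * D 1)" by blast
    with D have "((f \<circ> slice_map I) has_derivative (\<lambda>w. slice_map I w * D 1)) (at z)"
      by (rule back_subst[where P = "\<lambda>D. ((f \<circ> slice_map I) has_derivative D) (at z)"])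
    then show "\<exists>d. ((f \<circ> slice_map I) has_derivative (\<lambda>w. slice_map I w * d)) (at z)" ..
  qed
next
  assume U: "open U"
    and hol: "\<forall>I\<in>imag_units. slice_holomorphic_on I (f \<circ> slice_map I) (slice_map I -` U)"
  show "slice_regular_on f U"
    unfolding slice_regular_on_def slice_regular_on_domain_def
  proof (intro conjI ballI allI impI)
    show "open U" by fact
    fix C assume C: "C \<in> components U"
    then show "quat_domain C"
      unfolding quat_domain_def
      by (auto intro: open_components[OF U] in_components_connected dest: in_components_nonempty)
    fix I assume I: "I \<in> imag_units"
    let ?V = "slice_map I -` C"
    have V: "open ?V" by (rule open_slice_map_vimage[OF open_components[OF U C]])
    have "slice_holomorphic_on I (f \<circ> slice_map I) ?V"
      using hol I in_components_subset[OF C] by (blast intro: slice_holomorphic_on_subset)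
    then obtain d where
      d: "\<And>z. z \<in> ?V \<Longrightarrow> ((f \<circ> slice_map I) has_derivative (\<lambda>w. slice_map I w * d z)) (at z)"
      unfolding slice_holomorphic_on_def by metis
    define F' where "F' z = Blinfun (\<lambda>w. slice_map I w * d z)" for z
    have F': "blinfun_apply (F' z) = (\<lambda>w. slice_map I w * d z)" for z
      unfolding F'_def
      by (intro bounded_linear_Blinfun_apply
          bounded_linear_compose[OF bounded_linear_mult_left bounded_linear_slice_map])
    have "continuous_on ?V d"
      by (rule slice_holomorphic_derivative_continuous[OF I V d])
    then have "continuous_on ?V F'"
      by (intro continuous_on_blinfun_componentwise) (auto simp: F' intro!: continuous_intros)
    with d show "C1_on (f \<circ> slice_map I) ?V"
      unfolding C1_on_def by (intro exI[of _ F'] conjI ballI) (simp_all only: F')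
    fix \<alpha> \<beta> assume "slice_map I (Complex \<alpha> \<beta>) \<in> C"
    then have "Complex \<alpha> \<beta> \<in> ?V" by simp
    from vector_derivatives_Complex[OF d[OF this]]
    show "vector_derivative (\<lambda>a. f (slice_map I (Complex a \<beta>))) (at \<alpha>)
          + I * vector_derivative (\<lambda>b. f (slice_map I (Complex \<alpha> b))) (at \<beta>) = 0"
      by (simp add: slice_map_scaleR_mult imag_unit_square_left[OF I])
  qed
qed

section \<open>Stem functions\<close>

text \<open>Two distinct units are what it takes to solve for a stem. The second one is found by
  moving \<open>J\<close> slightly in a direction not parallel to it and normalising.\<close>

lemma ex_other_imag_unit:
  assumes J: "J \<in> imag_units" and e: "e > 0"
  obtains K where "K \<in> imag_units" "K \<in> ball J e" "K \<noteq> J"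
proof -
  \<comment> \<open>Two orthogonal basis units cannot both be multiples of the same
    \<open>J\<close>.\<close>
  obtain L where L: "L = Quat 0 1 0 0 \<or> L = Quat 0 0 1 0" and np: "\<And>c. L \<noteq> c *\<^sub>R J"
  proof (cases "\<exists>c. Quat 0 1 0 0 = c *\<^sub>R J")
    case False
    then show ?thesis using that by blast
  next
    case True
    then have "Quat 0 0 1 0 \<noteq> c *\<^sub>R J" for c by (auto simp: quat_eq_iff)
    then show ?thesis using that by blast
  qed
  have nz: "J + t *\<^sub>R L \<noteq> 0" for t
  proof
    assume *: "J + t *\<^sub>R L = 0"
    then have "J = (- t) *\<^sub>R L" by (simp add: eq_neg_iff_add_eq_0)
    moreover from this J have "t \<noteq> 0" by (auto simp: imag_units_iff)
    ultimately have "L = (- inverse t) *\<^sub>R J" by simp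
    with np show False by blast
  qed
  \<comment> \<open>Since \<open>sgn\<close> is continuous away from 0 and the value at
    \<open>t = 0\<close> is \<open>J\<close> itself, a small nonzero \<open>t\<close> stays within
    \<open>e\<close> of \<open>J\<close>.\<close>
  have "((\<lambda>t. sgn (J + t *\<^sub>R L)) \<longlongrightarrow> sgn (J + 0 *\<^sub>R L)) (at 0)"
    using nz[of 0] by (intro tendsto_intros)
  then have "\<forall>\<^sub>F t in at 0. sgn (J + t *\<^sub>R L) \<in> ball J e"
    using J e by (intro topological_tendstoD) (auto simp: imag_units_iff sgn_div_norm)
  moreover have "\<forall>\<^sub>F t in at (0::real). t \<noteq> 0" by (simp add: eventually_at_filter)
  ultimately have "\<forall>\<^sub>F t in at 0. sgn (J + t *\<^sub>R L) \<in> ball J e \<and> t \<noteq> 0"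
    by (rule eventually_conj)
  then obtain t where t: "sgn (J + t *\<^sub>R L) \<in> ball J e" "t \<noteq> 0"
    using eventually_happens trivial_limit_at by blast
  have "sgn (J + t *\<^sub>R L) \<noteq> J"
  proof
    assume "sgn (J + t *\<^sub>R L) = J"
    then have "norm (J + t *\<^sub>R L) *\<^sub>R sgn (J + t *\<^sub>R L) = norm (J + t *\<^sub>R L) *\<^sub>R J" by simp
    then have "J + t *\<^sub>R L = norm (J + t *\<^sub>R L) *\<^sub>R J"
      by (simp add: sgn_div_norm nz)
    then have "t *\<^sub>R L = (norm (J + t *\<^sub>R L) - 1) *\<^sub>R J"
      unfolding scaleR_left_diff_distrib by (simp add: algebra_simps)
    then have "inverse t *\<^sub>R t *\<^sub>R L = inverse t *\<^sub>R (norm (J + t *\<^sub>R L) - 1) *\<^sub>R J"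
      by (rule arg_cong)
    with t(2) have "L = (inverse t * (norm (J + t *\<^sub>R L) - 1)) *\<^sub>R J" by simp
    with np show False by blast
  qed
  moreover have "sgn (J + t *\<^sub>R L) \<in> imag_units"
    using J L nz[of t] by (auto simp: imag_units_iff norm_sgn sgn_div_norm)
  ultimately show ?thesis using that t by blast
qed

lemma norm_slice_map_le:
  assumes "J \<in> imag_units"
  shows "norm (slice_map J z) \<le> 2 * norm z"
proof -
  have "norm (slice_map J z) \<le> \<bar>Re z\<bar> + \<bar>Im z\<bar>"
    unfolding slice_map_def by (rule order.trans[OF norm_triangle_ineq]) (use assms in \<open>simp add: imag_units_iff\<close>)
  then show ?thesis using abs_Re_le_cmod[of z] abs_Im_le_cmod[of z] by linarith
qed

text \<open>Joint continuity in the unit and the coordinate yields one radius that serves for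
  both.\<close>

lemma slice_map_near:
  assumes "open U" "slice_map J z \<in> U"
  shows "\<exists>r>0. \<forall>K\<in>ball J r. \<forall>w\<in>ball z r. slice_map K w \<in> U"
proof -
  let ?\<phi> = "\<lambda>p. slice_map (fst p) (snd p)"
  have "continuous_on UNIV ?\<phi>"
    unfolding slice_map_def by (intro continuous_intros)
  then have "open (?\<phi> -` U)" by (rule open_vimage[OF assms(1)])
  moreover have "(J, z) \<in> ?\<phi> -` U" using assms(2) by simp
  ultimately obtain r where r: "r > 0" "ball (J, z) r \<subseteq> ?\<phi> -` U"
    using open_contains_ball by blast
  show ?thesis
  proof (intro exI[of _ "r / 2"] conjI ballI)
    fix K w assume "K \<in> ball J (r / 2)" "w \<in> ball z (r / 2)"
    then have "dist J K + dist z w < r" by simp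
    moreover have "dist (J, z) (K, w) \<le> dist J K + dist z w"
      by (simp add: dist_Pair_Pair sqrt_sum_squares_le_sum)
    ultimately have "(K, w) \<in> ball (J, z) r" by simp
    with r(2) show "slice_map K w \<in> U" by auto
  qed (use r in simp)
qed

section \<open>Local stems and the representation formula\<close>

locale slice_regular_function =
  fixes \<Omega> :: "quat set" and f :: "quat \<Rightarrow> quat"
  assumes regular: "slice_regular_on f \<Omega>"
begin

lemma open_domain: "open \<Omega>"
  using regular by (simp add: slice_regular_on_iff)

lemma slice_holomorphic:
  "I \<in> imag_units \<Longrightarrow> slice_holomorphic_on I (\<lambda>z. f (slice_map I z)) (slice_map I -` \<Omega>)"
  using regular by (simp add: slice_regular_on_iff comp_def)

text \<open>The coefficients \<open>a\<close> and \<open>b\<close> do not depend on the unit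
  \<open>K\<close>. Intersecting with \<open>imag_units\<close> lets \<open>N\<close> be a ball of
  quaternions or \<open>UNIV\<close>.\<close>

definition stem_on :: "quat set \<Rightarrow> complex set \<Rightarrow> (complex \<Rightarrow> quat) \<Rightarrow> (complex \<Rightarrow> quat) \<Rightarrow> bool" where
  "stem_on N U a b \<longleftrightarrow> (\<forall>K\<in>N \<inter> imag_units. \<forall>w\<in>U.
    slice_map K w \<in> \<Omega> \<and> f (slice_map K w) = a w + K * b w)"

lemma stem_onD:
  assumes "stem_on N U a b" "K \<in> N" "K \<in> imag_units" "w \<in> U"
  shows "slice_map K w \<in> \<Omega>" "f (slice_map K w) = a w + K * b w"
  using assms unfolding stem_on_def by auto

lemma stem_on_subset: "stem_on N U a b \<Longrightarrow> N' \<subseteq> N \<Longrightarrow> U' \<subseteq> U \<Longrightarrow> stem_on N' U' a b"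
  unfolding stem_on_def by blast

text \<open>Together with \<open>stem_re\<close>, this solves the two equations
  \<open>a + K * b = f (slice_map K w)\<close> and \<open>a + L * b = f (slice_map L w)\<close> for
  \<open>a\<close> and \<open>b\<close>.\<close>

definition stem_im :: "quat \<Rightarrow> quat \<Rightarrow> complex \<Rightarrow> quat" where
  "stem_im K L w = inverse (K - L) * (f (slice_map K w) - f (slice_map L w))"

definition stem_re :: "quat \<Rightarrow> quat \<Rightarrow> complex \<Rightarrow> quat" where
  "stem_re K L w = f (slice_map K w) - K * stem_im K L w"

lemma stem_on_eq:
  assumes "stem_on N U a b" "K \<in> N \<inter> imag_units" "L \<in> N \<inter> imag_units" "K \<noteq> L" "w \<in> U"
  shows "a w = stem_re K L w" "b w = stem_im K L w"
proof -
  have "f (slice_map K w) = a w + K * b w" "f (slice_map L w) = a w + L * b w"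
    using assms by (auto dest: stem_onD)
  moreover from this have "f (slice_map K w) - f (slice_map L w) = (K - L) * b w"
    by (simp add: algebra_simps)
  ultimately show "a w = stem_re K L w" "b w = stem_im K L w"
    using assms(4) by (simp_all add: stem_re_def stem_im_def flip: mult.assoc)
qed

text \<open>The stem built from the slices \<open>K\<close> and \<open>L\<close> inherits
  Cauchy-Riemann equations that no longer mention a unit, so it may be recombined with any third
  unit \<open>I\<close>.\<close>

lemma stem_slice_holomorphic:
  assumes K: "K \<in> imag_units" and L: "L \<in> imag_units" and KL: "K \<noteq> L" and I: "I \<in> imag_units"
    and U: "\<And>w. w \<in> U \<Longrightarrow> slice_map K w \<in> \<Omega>" "\<And>w. w \<in> U \<Longrightarrow> slice_map L w \<in> \<Omega>"
  shows "slice_holomorphic_on I (\<lambda>w. stem_re K L w + I * stem_im K L w) U"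
  unfolding slice_holomorphic_on_def
proof
  fix z assume z: "z \<in> U"
  from U[OF z] slice_holomorphic[OF K] slice_holomorphic[OF L] obtain d1 d2 where
    d1: "((\<lambda>z. f (slice_map K z)) has_derivative (\<lambda>w. slice_map K w * d1)) (at z)" and
    d2: "((\<lambda>z. f (slice_map L z)) has_derivative (\<lambda>w. slice_map L w * d2)) (at z)"
    unfolding slice_holomorphic_on_def by (metis vimageI)
  \<comment> \<open>The stem of the derivatives: \<open>d1\<close> and \<open>d2\<close> are split
    as the values of \<open>f\<close> are in \<open>stem_re\<close> and
    \<open>stem_im\<close>.\<close>
  define db where "db = inverse (K - L) * (d1 - d2)"
  define da where "da = d1 - K * db"
  have db: "(K - L) * db = d1 - d2"
    using KL by (simp add: db_def flip: mult.assoc)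
  have d1_eq: "d1 = da + K * db" by (simp add: da_def)
  have d2_eq: "d2 = da + L * db" using db by (simp add: da_def algebra_simps)
  text \<open>The stem functions satisfy the Cauchy-Riemann equations.\<close>
  have "slice_map K w * d1 - slice_map L w * d2 = (K - L) * (Re w *\<^sub>R db + Im w *\<^sub>R da)" for w
    by (simp add: d1_eq d2_eq slice_map_scaleR_mult distrib_left imag_unit_square_left[OF K]
        imag_unit_square_left[OF L] scaleR_add_right) (simp add: algebra_simps)
  then have "inverse (K - L) * (slice_map K w * d1 - slice_map L w * d2) =
      Re w *\<^sub>R db + Im w *\<^sub>R da" for w
    using KL by (simp flip: mult.assoc)
  moreover have "(stem_im K L has_derivative
      (\<lambda>w. inverse (K - L) * (slice_map K w * d1 - slice_map L w * d2))) (at z)"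
    unfolding stem_im_def [abs_def]
    by (rule bounded_linear.has_derivative[OF bounded_linear_mult_right has_derivative_diff[OF d1 d2]])
  ultimately have im: "(stem_im K L has_derivative (\<lambda>w. Re w *\<^sub>R db + Im w *\<^sub>R da)) (at z)"
    by simp
  have eq: "(\<lambda>w. stem_re K L w + I * stem_im K L w) =
      (\<lambda>w. f (slice_map K w) - K * stem_im K L w + I * stem_im K L w)"
    by (simp add: stem_re_def)
  have "((\<lambda>w. stem_re K L w + I * stem_im K L w) has_derivative
      (\<lambda>w. slice_map K w * d1 - K * (Re w *\<^sub>R db + Im w *\<^sub>R da) + I * (Re w *\<^sub>R db + Im w *\<^sub>R da)))
      (at z)"
    unfolding eq
    by (rule has_derivative_add[OF has_derivative_diff[OF d1
        bounded_linear.has_derivative[OF bounded_linear_mult_right im]]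
        bounded_linear.has_derivative[OF bounded_linear_mult_right im]])
  moreover have "slice_map K w * d1 - K * (Re w *\<^sub>R db + Im w *\<^sub>R da)
      + I * (Re w *\<^sub>R db + Im w *\<^sub>R da) = slice_map I w * (da + I * db)" for w
    by (simp add: d1_eq slice_map_scaleR_mult distrib_left imag_unit_square_left[OF K]
        imag_unit_square_left[OF I] scaleR_add_right)
  ultimately show "\<exists>d. ((\<lambda>w. stem_re K L w + I * stem_im K L w) has_derivative
      (\<lambda>w. slice_map I w * d)) (at z)"
    by auto
qed

text \<open>
  The representation formula: the identity principle propagates it from \<open>Z\<close> to all of \<open>U\<close>.
\<close>

lemma stem_on_extend:
  assumes K: "K \<in> N \<inter> imag_units" and L: "L \<in> N \<inter> imag_units" and KL: "K \<noteq> L"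
    and U: "open U" "connected U" "Z \<subseteq> U" "\<xi> \<in> U" "\<xi> islimpt Z"
    and dom: "\<And>I w. I \<in> N \<inter> imag_units \<Longrightarrow> w \<in> U \<Longrightarrow> slice_map I w \<in> \<Omega>"
    and Z: "\<And>I w. I \<in> N \<inter> imag_units \<Longrightarrow> w \<in> Z \<Longrightarrow>
      f (slice_map I w) = stem_re K L w + I * stem_im K L w"
  shows "stem_on N U (stem_re K L) (stem_im K L)"
  unfolding stem_on_def
proof (intro ballI conjI)
  fix I w assume I: "I \<in> N \<inter> imag_units" and w: "w \<in> U"
  show "slice_map I w \<in> \<Omega>" by (rule dom[OF I w])
  have "slice_holomorphic_on I (\<lambda>w. stem_re K L w + I * stem_im K L w) U"
    by (rule stem_slice_holomorphic) (use K L KL I dom in auto)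
  moreover have "slice_holomorphic_on I (\<lambda>w. f (slice_map I w)) U"
    by (rule slice_holomorphic_on_subset[OF slice_holomorphic]) (use I dom in auto)
  ultimately have "slice_holomorphic_on I
      (\<lambda>w. f (slice_map I w) - (stem_re K L w + I * stem_im K L w)) U"
    by (intro slice_holomorphic_on_diff)
  from slice_holomorphic_identity[OF _ this U _ w] I Z[OF I]
  show "f (slice_map I w) = stem_re K L w + I * stem_im K L w" by simp
qed

text \<open>All slices share the real points near \<open>z\<close>. There the formula is trivial,
  with vanishing \<open>stem_im\<close>, and the identity principle spreads it over the ball for all
  units at once.\<close>

lemma stem_on_real:
  assumes z: "Im z = 0" "slice_map J z \<in> \<Omega>"
  obtains e a b where "e > 0" "stem_on UNIV (ball z e) a b"
proof -
  obtain r where r: "r > 0" "ball (slice_map J z) r \<subseteq> \<Omega>"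
    using open_domain z(2) by (meson open_contains_ball)
  \<comment> \<open>The factor 2 of \<open>norm_slice_map_le\<close> is absorbed here.\<close>
  define e where "e = r / 2"
  have e: "e > 0" using r(1) by (simp add: e_def)
  have dom: "slice_map I w \<in> \<Omega>" if "I \<in> imag_units" "w \<in> ball z e" for I w
  proof -
    interpret bounded_linear "slice_map I" by (rule bounded_linear_slice_map)
    have "slice_map J z = slice_map I z" using z(1) by (simp add: slice_map_real)
    then have "dist (slice_map J z) (slice_map I w) = norm (slice_map I (z - w))"
      by (simp add: dist_norm diff)
    also have "\<dots> \<le> 2 * norm (z - w)" by (rule norm_slice_map_le[OF that(1)])
    also have "\<dots> < r" using that(2) by (simp add: e_def dist_norm)
    finally show ?thesis using r(2) by auto
  qed
  obtain K :: quat where K: "K \<in> imag_units" using ex_imag_unit by blast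
  let ?Z = "{w \<in> ball z e. Im w = 0}"
  have lim: "z islimpt ?Z"
    unfolding islimpt_approachable
  proof (intro allI impI)
    fix d :: real assume d: "d > 0"
    then show "\<exists>w\<in>?Z. w \<noteq> z \<and> dist w z < d"
      using z(1) e
      by (intro bexI[of _ "z + of_real (min d e / 2)"]) (auto simp: dist_norm)
  qed
  have Keq: "K \<noteq> - K"
  proof
    assume "K = - K"
    then have "K = 0" by (simp add: quat_eq_iff)
    with K show False by (simp add: imag_units_iff)
  qed
  have "stem_on UNIV (ball z e) (stem_re K (- K)) (stem_im K (- K))"
  proof (rule stem_on_extend)
    show "f (slice_map I w) = stem_re K (- K) w + I * stem_im K (- K) w" if "w \<in> ?Z" for I w
      using that by (simp add: stem_re_def stem_im_def slice_map_real)
  qed (use K Keq e lim dom in auto)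
  with e show ?thesis using that by blast
qed

section \<open>Units with a common stem\<close>

text \<open>Neighbourhoods of \<open>J\<close> and \<open>J'\<close> are essential: two single
  values over each point always fit some stem, whereas a ball around a unit contains further units
  and pins the stem down.\<close>

definition agree :: "quat \<Rightarrow> quat \<Rightarrow> complex \<Rightarrow> bool" where
  "agree J J' z \<longleftrightarrow> (\<exists>e>0. \<exists>a b. stem_on (ball J e \<union> ball J' e) (ball z e) a b)"

lemma agree_real: "Im z = 0 \<Longrightarrow> slice_map J z \<in> \<Omega> \<Longrightarrow> agree K L z"
  unfolding agree_def by (rule stem_on_real) (blast intro: stem_on_subset)+

lemma agree_sym: "agree J J' z \<Longrightarrow> agree J' J z"
  unfolding agree_def by (simp add: Un_commute)

text \<open>Both stems are valid at \<open>J'\<close> and at a second unit near it, and these two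
  units determine them, so the stems coincide.\<close>

lemma agree_trans:
  assumes "agree J J' z" "agree J' J'' z" and J': "J' \<in> imag_units"
  shows "agree J J'' z"
proof -
  from assms obtain e1 a1 b1 e2 a2 b2 where e: "e1 > 0" "e2 > 0"
    and s1: "stem_on (ball J e1 \<union> ball J' e1) (ball z e1) a1 b1"
    and s2: "stem_on (ball J' e2 \<union> ball J'' e2) (ball z e2) a2 b2"
    unfolding agree_def by blast
  define e where "e = min e1 e2"
  have e0: "e > 0" using e by (simp add: e_def)
  from ex_other_imag_unit[OF J' e0] obtain K where
    K: "K \<in> imag_units" "K \<in> ball J' e" "K \<noteq> J'" .
  have s1: "stem_on (ball J e \<union> ball J' e) (ball z e) a1 b1"
    by (rule stem_on_subset[OF s1]) (auto simp: e_def)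
  have s2: "stem_on (ball J' e \<union> ball J'' e) (ball z e) a2 b2"
    by (rule stem_on_subset[OF s2]) (auto simp: e_def)
  have "a1 w = a2 w \<and> b1 w = b2 w" if "w \<in> ball z e" for w
    using stem_on_eq[OF s1 _ _ K(3) that] stem_on_eq[OF s2 _ _ K(3) that] K J' e0 by simp
  then have "stem_on (ball J e \<union> ball J'' e) (ball z e) a1 b1"
    using s1 s2 unfolding stem_on_def by auto
  with e0 show ?thesis unfolding agree_def by blast
qed

lemma agree_imag_unit_near:
  assumes "agree J J' z"
  shows "\<exists>e>0. \<forall>K\<in>ball J' e. agree J K z"
proof -
  from assms obtain e a b where e: "e > 0" "stem_on (ball J e \<union> ball J' e) (ball z e) a b"
    unfolding agree_def by blast
  have "agree J K z" if K: "K \<in> ball J' e" for K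
    unfolding agree_def
  proof (intro exI conjI)
    let ?e = "e - dist J' K"
    show "0 < ?e" using K by simp
    have "ball K ?e \<subseteq> ball J' e" by (simp add: ball_subset_ball_iff dist_commute)
    moreover have "ball J ?e \<subseteq> ball J e" "ball z ?e \<subseteq> ball z e"
      by (intro subset_ball; simp)+
    ultimately show "stem_on (ball J ?e \<union> ball K ?e) (ball z ?e) a b"
      by (intro stem_on_subset[OF e(2)]) auto
  qed
  with e(1) show ?thesis by blast
qed

text \<open>The radius \<open>r\<close> depends only on the domain. A stem over a tiny ball anywhere
  inside \<open>ball z r\<close> extends to all of it, so agreement is both open and closed along
  the coordinate.\<close>

lemma agree_near:
  assumes J: "J \<in> imag_units" "slice_map J z \<in> \<Omega>" and J': "slice_map J' z \<in> \<Omega>"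
  shows "\<exists>r>0. \<forall>w\<in>ball z r. \<forall>w'\<in>ball z r. agree J J' w \<longrightarrow> agree J J' w'"
proof -
  from slice_map_near[OF open_domain J(2)] obtain r1 where
    r1: "r1 > 0" "\<And>K w. K \<in> ball J r1 \<Longrightarrow> w \<in> ball z r1 \<Longrightarrow> slice_map K w \<in> \<Omega>" by blast
  from slice_map_near[OF open_domain J'] obtain r2 where
    r2: "r2 > 0" "\<And>K w. K \<in> ball J' r2 \<Longrightarrow> w \<in> ball z r2 \<Longrightarrow> slice_map K w \<in> \<Omega>" by blast
  define r where "r = min r1 r2"
  have r: "r > 0" using r1 r2 by (simp add: r_def)
  have "agree J J' w'" if w: "w \<in> ball z r" "w' \<in> ball z r" "agree J J' w" for w w'
  proof -
    from w(3) obtain e0 a b where e0: "e0 > 0"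
      and st0: "stem_on (ball J e0 \<union> ball J' e0) (ball w e0) a b"
      unfolding agree_def by blast
    obtain e1 where e1: "e1 > 0" "ball w e1 \<subseteq> ball z r"
      using w(1) open_contains_ball[of "ball z r"] by blast
    \<comment> \<open>The bound \<open>r\<close> keeps the slices of nearby units inside \<Omega>
      over all of \<open>ball z r\<close>, \<open>e0\<close> keeps the given stem valid, and
      \<open>e1\<close> keeps the small ball inside the large one.\<close>
    define e where "e = min r (min e0 e1)"
    have e: "e > 0" using e0 e1 r by (simp add: e_def)
    have st: "stem_on (ball J e \<union> ball J' e) (ball w e) a b"
      by (rule stem_on_subset[OF st0]) (auto simp: e_def)
    from ex_other_imag_unit[OF J(1) e] obtain K where
      K: "K \<in> imag_units" "K \<in> ball J e" "K \<noteq> J" .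
    have ext: "stem_on (ball J e \<union> ball J' e) (ball z r) (stem_re K J) (stem_im K J)"
    proof (rule stem_on_extend)
      show "ball w e \<subseteq> ball z r" using e1(2) by (auto simp: e_def)
      show "w islimpt ball w e" using e by (simp add: islimpt_ball)
      show "slice_map I v \<in> \<Omega>" if "I \<in> (ball J e \<union> ball J' e) \<inter> imag_units" "v \<in> ball z r" for I v
        using that r1(2)[of I v] r2(2)[of I v] by (auto simp: e_def r_def)
      show "f (slice_map I v) = stem_re K J v + I * stem_im K J v"
        if "I \<in> (ball J e \<union> ball J' e) \<inter> imag_units" "v \<in> ball w e" for I v
        using stem_on_eq[OF st _ _ K(3) that(2)] stem_onD(2)[OF st _ _ that(2), of I] that(1) K J(1) e
        by auto
    qed (use K J(1) w(1) e in auto)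
    obtain e2 where e2: "e2 > 0" "ball w' e2 \<subseteq> ball z r"
      using w(2) open_contains_ball[of "ball z r"] by blast
    have "stem_on (ball J (min e e2) \<union> ball J' (min e e2)) (ball w' (min e e2))
        (stem_re K J) (stem_im K J)"
      by (rule stem_on_subset[OF ext]) (use e2(2) in auto)
    moreover have "min e e2 > 0" using e e2 by simp
    ultimately show ?thesis unfolding agree_def by blast
  qed
  with r show ?thesis by blast
qed

lemma agree_connected:
  assumes J: "J \<in> imag_units" and T: "connected T"
    and dom: "\<And>w. w \<in> T \<Longrightarrow> slice_map J w \<in> \<Omega>" "\<And>w. w \<in> T \<Longrightarrow> slice_map J' w \<in> \<Omega>"
    and z: "z \<in> T" "w \<in> T" "agree J J' z"
  shows "agree J J' w"
proof (rule connected_induction_simple[OF T z(1,2), of "agree J J'"])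
  show "agree J J' z" by fact
  fix v assume v: "v \<in> T"
  from agree_near[OF J dom(1)[OF v] dom(2)[OF v]] obtain r where
    "r > 0" "\<forall>w\<in>ball v r. \<forall>w'\<in>ball v r. agree J J' w \<longrightarrow> agree J J' w'" by blast
  with v show "\<exists>S. openin (top_of_set T) S \<and> v \<in> S \<and> (\<forall>x\<in>S. \<forall>y\<in>S. agree J J' x \<longrightarrow> agree J J' y)"
    by (intro exI[of _ "T \<inter> ball v r"]) (auto intro: openin_open_Int)
qed

end

section \<open>Hinged points\<close>

text \<open>The definition of \<open>conj_sphere\<close> also admits coordinates in the lower half
  plane, hence the absolute value.\<close>

lemma upper_coord_slice_map_abs:
  assumes "J \<in> imag_units"
  shows "upper_coord (slice_map J z) = Complex (Re z) \<bar>Im z\<bar>"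
  using assms by (simp add: upper_coord_def slice_map_def imag_units_iff)

lemma conj_sphere_iff: "y \<in> conj_sphere x \<longleftrightarrow> upper_coord y = upper_coord x"
proof
  assume "y \<in> conj_sphere x"
  then show "upper_coord y = upper_coord x"
    unfolding conj_sphere_def by (auto simp: upper_coord_slice_map_abs)
next
  assume *: "upper_coord y = upper_coord x"
  obtain I where I: "I \<in> imag_units" "x = slice_map I (upper_coord x)"
    using ex_slice_map_upper_coord by blast
  obtain J where "J \<in> imag_units" "y = slice_map J (upper_coord x)"
    using ex_slice_map_upper_coord[of y] * by auto
  with I show "y \<in> conj_sphere x"
    unfolding conj_sphere_def by blast
qed

text \<open>Off the real axis the unit and the upper coordinate are unique; at real points only the
  unit is free. Each choice of a representation below is checked against this.\<close>

lemma slice_map_eq_upper: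
  assumes "slice_map J z = slice_map K w" "J \<in> imag_units" "K \<in> imag_units" "Im z \<ge> 0" "Im w \<ge> 0"
  shows "z = w" "Im z = 0 \<or> J = K"
proof -
  show "z = w" using assms upper_coord_slice_map by metis
  with assms(1) have "Im z *\<^sub>R J = Im z *\<^sub>R K" by (simp add: slice_map_def)
  then show "Im z = 0 \<or> J = K" by auto
qed

lemma symmetric_completion_iff:
  "x \<in> symmetric_completion T \<longleftrightarrow> (\<exists>J\<in>imag_units. slice_map J (upper_coord x) \<in> T)"
proof
  assume "x \<in> symmetric_completion T"
  then obtain y where "y \<in> T" "upper_coord x = upper_coord y"
    unfolding symmetric_completion_def by (auto simp: conj_sphere_iff)
  then show "\<exists>J\<in>imag_units. slice_map J (upper_coord x) \<in> T"
    using ex_slice_map_upper_coord[of y] by metis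
next
  assume "\<exists>J\<in>imag_units. slice_map J (upper_coord x) \<in> T"
  then obtain J where J: "J \<in> imag_units" "slice_map J (upper_coord x) \<in> T" by blast
  then have "x \<in> conj_sphere (slice_map J (upper_coord x))"
    by (simp add: conj_sphere_iff upper_coord_slice_map)
  with J(2) show "x \<in> symmetric_completion T"
    unfolding symmetric_completion_def by blast
qed

lemma subset_symmetric_completion: "T \<subseteq> symmetric_completion T"
  unfolding symmetric_completion_def by (auto simp: conj_sphere_iff)

text \<open>For fixed \<open>J\<close>, the map that moves \<open>x\<close> along its sphere into
  the half slice of \<open>J\<close> is continuous, and the completion is the union of the preimages
  of \<open>T\<close> under these maps.\<close>

lemma open_symmetric_completion:
  assumes "open T"
  shows "open (symmetric_completion T)"
proof -
  have "open ((\<lambda>x. slice_map J (upper_coord x)) -` T)" for J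
    by (rule open_vimage[OF assms continuous_slice_map[OF continuous_on_const
          continuous_on_upper_coord]])
  moreover have "symmetric_completion T =
      (\<Union>J\<in>imag_units. (\<lambda>x. slice_map J (upper_coord x)) -` T)"
    by (auto simp: symmetric_completion_iff)
  ultimately show ?thesis by auto
qed

section \<open>Reaching the reals, and uniqueness of the extension\<close>

text \<open>\<open>T\<close> is the component of the half slice through the given point, transported
  to the complex plane; the speared condition puts a real point into it.\<close>

lemma speared_connected_to_real:
  assumes "speared U" and J: "J \<in> imag_units" and z: "Im z \<ge> 0" "slice_map J z \<in> U"
  obtains T r where "connected T" "z \<in> T" "r \<in> T" "Im r = 0"
    "\<And>w. w \<in> T \<Longrightarrow> Im w \<ge> 0 \<and> slice_map J w \<in> U"
proof -
  let ?H = "U \<inter> half_slice J"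
  define C where "C = connected_component_set ?H (slice_map J z)"
  have zH: "slice_map J z \<in> ?H" using z unfolding half_slice_def by blast
  then have C: "C \<in> components ?H" unfolding C_def by (rule componentsI)
  have zC: "slice_map J z \<in> C" using zH unfolding C_def by simp
  from C assms(1) J have "C \<inter> \<real> \<noteq> {}" unfolding speared_def by blast
  then obtain r where r: "of_real r \<in> C" by (auto elim: Reals_cases)
  have CH: "C \<subseteq> ?H" by (rule in_components_subset[OF C])
  show thesis
  proof (rule that[of "slice_coord J ` C" "slice_coord J (of_real r)"])
    show "connected (slice_coord J ` C)"
      by (rule connected_continuous_image[OF continuous_on_slice_coord in_components_connected[OF C]])
    show "z \<in> slice_coord J ` C"
      using zC slice_coord_slice_map[OF J, of z] by (metis imageI)
    show "slice_coord J (of_real r) \<in> slice_coord J ` C" using r by blast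
    show "Im (slice_coord J (of_real r)) = 0"
      using J by (simp add: slice_coord_def of_real_def imag_units_iff)
    fix w assume "w \<in> slice_coord J ` C"
    with CH obtain v where "Im v \<ge> 0" "slice_map J v \<in> U" "w = slice_coord J (slice_map J v)"
      unfolding half_slice_def by blast
    then show "Im w \<ge> 0 \<and> slice_map J w \<in> U" by (simp add: slice_coord_slice_map[OF J])
  qed
qed

text \<open>On the slice through \<open>x\<close> the two functions agree near a real point of
  \<open>D\<close>, and the component containing that point reaches \<open>x\<close>, so the
  identity principle applies.\<close>

lemma slice_regular_unique_extension:
  assumes D: "speared D"
    and g: "slice_regular_on g (symmetric_completion D)"
    and h: "slice_regular_on h (symmetric_completion D)"
    and eq: "\<And>x. x \<in> D \<Longrightarrow> g x = h x" and x: "x \<in> symmetric_completion D"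
  shows "g x = h x"
proof -
  let ?S = "symmetric_completion D" and ?z = "upper_coord x"
  obtain J where J: "J \<in> imag_units" "slice_map J ?z \<in> D"
    using x by (auto simp: symmetric_completion_iff)
  obtain I where I: "I \<in> imag_units" "x = slice_map I ?z"
    using ex_slice_map_upper_coord by blast
  from speared_connected_to_real[OF D J(1) _ J(2)] obtain T r where
    T: "connected T" "?z \<in> T" "r \<in> T" "Im r = 0"
      "\<And>w. w \<in> T \<Longrightarrow> Im w \<ge> 0 \<and> slice_map J w \<in> D"
    using Im_upper_coord by blast
  let ?W = "slice_map I -` ?S"
  have W: "open ?W" using g by (intro open_slice_map_vimage) (simp add: slice_regular_on_def)
  \<comment> \<open>\<open>T\<close> was found in the slice of \<open>J\<close>; the completion
    contains whole spheres, hence also its copy in the slice of \<open>I\<close>.\<close>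
  have TW: "T \<subseteq> ?W"
    using T(5) J(1) I(1) by (force simp: symmetric_completion_iff upper_coord_slice_map)
  let ?C = "connected_component_set ?W r"
  have TC: "T \<subseteq> ?C" by (rule connected_component_maximal[OF T(3) T(1) TW])
  have CW: "?C \<subseteq> ?W" by (rule connected_component_subset)
  have openD: "open D" using D by (simp add: speared_def)
  have "slice_map I r \<in> D" using T(3-5) by (metis slice_map_real)
  then obtain e where e: "e > 0" "ball r e \<subseteq> slice_map I -` D"
    using open_slice_map_vimage[OF openD, of I] open_contains_ball by blast
  have eC: "ball r e \<subseteq> ?C"
    by (rule connected_component_maximal)
      (use e subset_symmetric_completion[of D] in auto)
  have "slice_holomorphic_on I (\<lambda>w. g (slice_map I w) - h (slice_map I w)) ?C"
    by (rule slice_holomorphic_on_subset[OF slice_holomorphic_on_diff CW])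
      (use g h I(1) in \<open>simp_all add: slice_regular_on_iff comp_def\<close>)
  then have "g (slice_map I ?z) - h (slice_map I ?z) = 0"
  proof (rule slice_holomorphic_identity[OF I(1) _ open_connected_component[OF W]
        connected_connected_component eC])
    show "r \<in> ?C" "?z \<in> ?C" using TC T(2,3) by blast+
    show "r islimpt ball r e" using e(1) by (simp add: islimpt_ball)
    show "g (slice_map I w) - h (slice_map I w) = 0" if "w \<in> ball r e" for w
      using that e(2) eq by auto
  qed
  then show ?thesis unfolding I(2)[symmetric] by simp
qed

text \<open>
  Here \<open>(p m, q m)\<close> are the double steps of a chain; \<open>E u v\<close> says that the function has the same
  stem at the \<open>u\<close>-th and \<open>v\<close>-th points. A segment is handled by removing either its first step or
  the block between \<open>p m\<close> and \<open>q m\<close> that starts there.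
\<close>

lemma nested_steps_related:
  fixes p q :: "'m::linorder \<Rightarrow> nat"
  assumes refl: "\<And>u. u \<le> t \<Longrightarrow> E u u"
    and trans: "\<And>u v w. E u v \<Longrightarrow> E v w \<Longrightarrow> E u w"
    and step: "\<And>u. u < t \<Longrightarrow> E u (Suc u) \<or> u \<in> p ` M \<union> q ` M"
    and double: "\<And>m. m \<in> M \<Longrightarrow> p m < q m \<and> (E (Suc (p m)) (q m) \<longrightarrow> E (p m) (Suc (q m)))"
    and nested: "\<And>m n. m \<in> M \<Longrightarrow> n \<in> M \<Longrightarrow> m < n \<Longrightarrow> p m < p n \<and> (q m < p n \<or> q m > q n)"
  shows "u \<le> v \<Longrightarrow> v \<le> t \<Longrightarrow> (\<And>m. m \<in> M \<Longrightarrow> p m \<in> {u..<v} \<longleftrightarrow> q m \<in> {u..<v}) \<Longrightarrow> E u v"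
proof (induction "v - u" arbitrary: u v rule: less_induct)
  case less
  note closed = less.prems(3)
  show ?case
  proof (cases "u = v")
    case True
    then show ?thesis using refl less.prems by simp
  next
    case False
    then have uv: "u < v" using less.prems by simp
    \<comment> \<open>If the segment began at some \<open>q m\<close>, then \<open>p m\<close> would
      have to lie in it too, but it comes earlier.\<close>
    have "u \<notin> q ` M"
    proof
      assume "u \<in> q ` M"
      then obtain m where "m \<in> M" "u = q m" by blast
      with double[of m] closed[of m] uv show False by simp
    qed
    with step[of u] uv less.prems(2) consider "E u (Suc u)" "u \<notin> p ` M" | m where "m \<in> M" "u = p m"
      by auto
    then show ?thesis
    proof cases
      case 1
      have "E (Suc u) v"
      proof (rule less.hyps)
        fix m assume m: "m \<in> M"
        with 1 \<open>u \<notin> q ` M\<close> have "p m \<noteq> u" "q m \<noteq> u" by blast+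
        with closed[OF m] show "p m \<in> {Suc u..<v} \<longleftrightarrow> q m \<in> {Suc u..<v}" by auto
      qed (use uv less.prems in auto)
      with 1 show ?thesis using trans by blast
    next
      case (2 m)
      have pq: "p m < q m" and qv: "q m < v" using double[of m] closed[of m] 2 uv by auto
      \<comment> \<open>The inside of the block is again closed: a double step with smaller index
        starts before \<open>u\<close> and ends outside the block, one with larger index lies wholly
        inside or wholly after it.\<close>
      have "E (Suc u) (q m)"
      proof (rule less.hyps)
        fix n assume n: "n \<in> M"
        show "p n \<in> {Suc u..<q m} \<longleftrightarrow> q n \<in> {Suc u..<q m}"
        proof (cases n m rule: linorder_cases)
          case less
          then show ?thesis using nested[OF n 2(1)] 2 by auto
        next
          case equal
          then show ?thesis using 2 by simp
        next
          case greater
          then show ?thesis using nested[OF 2(1) n] 2 double[OF n] by auto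
        qed
      qed (use pq qv 2 less.prems in auto)
      then have "E u (Suc (q m))" using double[OF 2(1)] 2(2) by simp
      moreover have "E (Suc (q m)) v"
      proof (rule less.hyps)
        fix n assume n: "n \<in> M"
        show "p n \<in> {Suc (q m)..<v} \<longleftrightarrow> q n \<in> {Suc (q m)..<v}"
        proof (cases n m rule: linorder_cases)
          case less
          then show ?thesis using nested[OF n 2(1)] 2 closed[OF n] pq by auto
        next
          case equal
          then show ?thesis using pq by simp
        next
          case greater
          then show ?thesis using nested[OF 2(1) n] 2 double[OF n] closed[OF n] by auto
        qed
      qed (use pq qv 2 less.prems in auto)
      ultimately show ?thesis using trans by blast
    qed
  qed
qed

section \<open>Links between points of one sphere\<close>

locale slice_regular_function_speared = slice_regular_function +
  assumes speared: "speared \<Omega>"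
begin

text \<open>This is the local representation formula at an arbitrary point: it holds at a real point
  and is carried along the half slice.\<close>

lemma agree_refl:
  assumes J: "J \<in> imag_units" and z: "Im z \<ge> 0" "slice_map J z \<in> \<Omega>"
  shows "agree J J z"
proof -
  from speared_connected_to_real[OF speared J z] obtain T r where
    T: "connected T" "z \<in> T" "r \<in> T" "Im r = 0"
      "\<And>w. w \<in> T \<Longrightarrow> Im w \<ge> 0 \<and> slice_map J w \<in> \<Omega>" by blast
  have "agree J J r" using agree_real T(3-5) by blast
  then show ?thesis using agree_connected[OF J T(1) _ _ T(3,2)] T(5) by blast
qed

text \<open>A version of \<open>agree\<close> for points instead of units, so that it can be
  composed along a chain. By \<open>linked_iff\<close> the chosen representation is
  immaterial.\<close>

definition linked :: "quat \<Rightarrow> quat \<Rightarrow> bool" where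
  "linked x x' \<longleftrightarrow> (\<exists>z J J'. Im z \<ge> 0 \<and> J \<in> imag_units \<and> J' \<in> imag_units \<and>
     x \<in> \<Omega> \<and> x' \<in> \<Omega> \<and> x = slice_map J z \<and> x' = slice_map J' z \<and> agree J J' z)"

lemma linked_iff:
  assumes J: "J \<in> imag_units" "slice_map J z \<in> \<Omega>" and J': "J' \<in> imag_units" "slice_map J' z \<in> \<Omega>"
    and z: "Im z \<ge> 0"
  shows "linked (slice_map J z) (slice_map J' z) \<longleftrightarrow> agree J J' z"
proof
  assume "linked (slice_map J z) (slice_map J' z)"
  then obtain w K K' where w: "Im w \<ge> 0" "K \<in> imag_units" "K' \<in> imag_units"
    and eq: "slice_map J z = slice_map K w" "slice_map J' z = slice_map K' w" and ag: "agree K K' w"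
    unfolding linked_def by blast
  show "agree J J' z"
  proof (cases "Im z = 0")
    case True
    then show ?thesis using agree_real J(2) by blast
  next
    case False
    with slice_map_eq_upper[OF eq(1) J(1) w(2) z w(1)] slice_map_eq_upper[OF eq(2) J'(1) w(3) z w(1)]
    show ?thesis using ag by simp
  qed
next
  assume "agree J J' z"
  with assms show "linked (slice_map J z) (slice_map J' z)" unfolding linked_def by blast
qed

lemma linked_refl: "x \<in> \<Omega> \<Longrightarrow> linked x x"
  using ex_slice_map_upper_coord[of x] linked_iff agree_refl Im_upper_coord by metis

lemma linked_sym: "linked x x' \<Longrightarrow> linked x' x"
  unfolding linked_def using agree_sym by blast

lemma linked_trans:
  assumes "linked x y" "linked y w"
  shows "linked x w"
proof -
  from assms(1) obtain z J K where 1: "Im z \<ge> 0" "J \<in> imag_units" "K \<in> imag_units"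
    "x \<in> \<Omega>" "y \<in> \<Omega>" "x = slice_map J z" "y = slice_map K z" "agree J K z"
    unfolding linked_def by blast
  from assms(2) obtain z' K' L where 2: "Im z' \<ge> 0" "K' \<in> imag_units" "L \<in> imag_units"
    "w \<in> \<Omega>" "y = slice_map K' z'" "w = slice_map L z'" "agree K' L z'"
    unfolding linked_def by blast
  have eq: "z = z'" "Im z = 0 \<or> K = K'"
    using slice_map_eq_upper[of K z K' z'] 1 2 by auto
  have "agree J L z"
    using eq(2)
  proof
    assume "Im z = 0"
    then show ?thesis using agree_real 1 by blast
  next
    assume "K = K'"
    then show ?thesis using agree_trans[OF 1(8), of L] 1(3) 2(7) eq(1) by simp
  qed
  with 1 2 eq(1) show ?thesis unfolding linked_def by blast
qed

text \<open>The path of the shadow lies over both half slices, and agreement travels along it in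
  either direction.\<close>

lemma shadows_linked_iff:
  assumes "shadows \<Omega> x1 y1 x0 y0"
  shows "linked x0 x1 \<longleftrightarrow> linked y0 y1"
proof -
  from assms obtain z w J0 J1 \<gamma> where z: "Im z \<ge> 0" "Im w \<ge> 0"
    and J: "J0 \<in> imag_units" "J1 \<in> imag_units"
    and eq: "x0 = slice_map J0 z" "x1 = slice_map J1 z" "y0 = slice_map J0 w" "y1 = slice_map J1 w"
    and dom: "x0 \<in> \<Omega>" "x1 \<in> \<Omega>" "y0 \<in> \<Omega>" "y1 \<in> \<Omega>"
    and \<gamma>: "path \<gamma>" "path_image \<gamma> \<subseteq> common_half_slice \<Omega> J0 J1" "pathstart \<gamma> = z" "pathfinish \<gamma> = w"
    unfolding shadows_def by blast
  let ?T = "path_image \<gamma>"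
  have T: "connected ?T" "z \<in> ?T" "w \<in> ?T"
    using connected_path_image[OF \<gamma>(1)] \<gamma>(3,4) by auto
  have TD: "slice_map J0 v \<in> \<Omega>" "slice_map J1 v \<in> \<Omega>" if "v \<in> ?T" for v
    using that \<gamma>(2) unfolding common_half_slice_def by auto
  have "agree J0 J1 z \<longleftrightarrow> agree J0 J1 w"
    using agree_connected[OF J(1) T(1) TD T(2,3)] agree_connected[OF J(1) T(1) TD T(3,2)] by blast
  then show ?thesis using linked_iff J z dom unfolding eq by simp
qed

lemma strongly_hinged_linked:
  assumes "strongly_hinged \<Omega> x' x"
  shows "linked x x'"
proof -
  from assms obtain y where "y \<in> \<Omega>" "shadows \<Omega> x' y x y" unfolding strongly_hinged_def by blast
  then show ?thesis using shadows_linked_iff linked_refl by blast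
qed

text \<open>Off the reals, the component corresponds to a connected set of units, on which agreement
  is an equivalence relation with open classes; hence there is a single class.\<close>

lemma connected_component_linked:
  assumes x: "x \<in> \<Omega>" and x': "x' \<in> connected_component_set (conj_sphere x \<inter> \<Omega>) x"
  shows "linked x x'"
proof -
  define z where "z = upper_coord x"
  have z: "Im z \<ge> 0" by (simp add: z_def)
  let ?C = "connected_component_set (conj_sphere x \<inter> \<Omega>) x"
  have C: "y \<in> \<Omega> \<and> upper_coord y = z" if "y \<in> ?C" for y
    using connected_component_in[of "conj_sphere x \<inter> \<Omega>" x y] that by (auto simp: conj_sphere_iff z_def)
  obtain J where J: "J \<in> imag_units" "x = slice_map J z"
    using ex_slice_map_upper_coord z_def by blast
  obtain J' where J': "J' \<in> imag_units" "x' = slice_map J' z"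
    using ex_slice_map_upper_coord C[OF x'] by metis
  have "agree J J' z"
  proof (cases "Im z = 0")
    case True
    then show ?thesis using agree_real J x by blast
  next
    case False
    \<comment> \<open>Recovers the unit of a point on the sphere; this needs \<open>Im z\<close> to
      be nonzero.\<close>
    define j where "j y = (y - of_real (Re z)) /\<^sub>R Im z" for y :: quat
    have j: "j (slice_map K z) = K" for K
      using False by (simp add: j_def slice_map_def)
    have T: "connected (j ` ?C)"
      unfolding j_def by (intro connected_continuous_image continuous_intros connected_connected_component)
    have TD: "K \<in> imag_units \<and> slice_map K z \<in> \<Omega>" if "K \<in> j ` ?C" for K
    proof -
      from that obtain y where y: "y \<in> ?C" "K = j y" by blast
      with C[OF y(1)] obtain L where "L \<in> imag_units" "y = slice_map L z"
        using ex_slice_map_upper_coord by metis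
      with y C[OF y(1)] show ?thesis by (simp add: j)
    qed
    have xC: "x \<in> ?C" using x by (simp add: conj_sphere_iff)
    show ?thesis
    proof (rule connected_equivalence_relation[OF T])
      show "J \<in> j ` ?C" using xC J(2) j by (metis imageI)
      show "J' \<in> j ` ?C" using x' J'(2) j by (metis imageI)
      show "\<exists>S. openin (top_of_set (j ` ?C)) S \<and> K \<in> S \<and> (\<forall>L\<in>S. agree K L z)"
        if K: "K \<in> j ` ?C" for K
      proof -
        obtain e where "e > 0" "\<forall>L\<in>ball K e. agree K L z"
          using agree_imag_unit_near[OF agree_refl[OF _ z]] TD[OF K] by blast
        with K show ?thesis
          by (intro exI[of _ "j ` ?C \<inter> ball K e"]) (auto intro: openin_open_Int)
      qed
    qed (use TD agree_sym agree_trans in blast)+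
  qed
  then show ?thesis using linked_iff[OF J(1) _ J'(1) _ z] J(2) J'(2) x C[OF x'] by simp
qed

section \<open>Chains preserve links\<close>

lemma simple_pair_linked: "simple_pair \<Omega> x s s' \<Longrightarrow> x s \<in> \<Omega> \<Longrightarrow> linked (x s) (x s')"
  unfolding simple_pair_def using connected_component_linked strongly_hinged_linked by blast

lemma simple_step_linked:
  assumes "simple_step \<Omega> t x u" "\<And>s. s \<le> t \<Longrightarrow> x s \<in> \<Omega>"
  shows "linked (x u) (x (Suc u))"
proof -
  from assms(1) obtain s s' where s: "s \<le> t" "s' \<le> t" "\<bar>int s - int s'\<bar> = 1" "u = min s s'"
    and sp: "simple_pair \<Omega> x s s'"
    unfolding simple_step_def by auto
  have l: "linked (x s) (x s')" using simple_pair_linked[OF sp] assms(2) s by simp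
  from s(3,4) have "s = u \<and> s' = Suc u \<or> s = Suc u \<and> s' = u" by auto
  with l linked_sym[OF l] show ?thesis by auto
qed

text \<open>The two steps run in opposite directions, so shadowing compares the inner endpoints
  \<open>Suc p\<close>, \<open>q\<close> with the outer endpoints \<open>p\<close>,
  \<open>Suc q\<close>. Subtracting 1 from the maximum makes \<open>q\<close> the lower index of the
  later step.\<close>

lemma double_step_linked:
  assumes "double_step \<Omega> t x p q"
  shows "p < q \<and> (linked (x (Suc p)) (x q) \<longrightarrow> linked (x p) (x (Suc q)))"
proof -
  from assms obtain s s' s2 s3 where s: "\<bar>int s - int s'\<bar> = 1" "s2 \<noteq> s" "s2 \<noteq> s'" "s3 \<noteq> s" "s3 \<noteq> s'"
      "int s2 - int s3 = int s' - int s"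
    and sh: "shadows \<Omega> (x s2) (x s3) (x s) (x s')"
    and pq: "p = Min {s, s', s2, s3}" "q = Max {s, s', s2, s3} - 1"
    unfolding double_step_def by blast
  have l: "linked (x s) (x s2) \<longleftrightarrow> linked (x s') (x s3)"
    by (rule shadows_linked_iff[OF sh])
  then have l': "linked (x s2) (x s) \<longleftrightarrow> linked (x s3) (x s')"
    using linked_sym by blast
  have p: "p = min s (min s' (min s2 s3))" and q: "q = max s (max s' (max s2 s3)) - 1"
    by (simp_all add: pq)
  have "s' = Suc s \<and> s2 = Suc s3 \<or> s = Suc s' \<and> s3 = Suc s2"
    using s(1,6) by linarith
  moreover have "s < s3 \<or> s3 < s" "s' < s2 \<or> s2 < s'" using s(2-5) by linarith+
  \<comment> \<open>The cases record the direction of the first step and which of the two steps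
    comes earlier.\<close>
  ultimately consider
      "s' = Suc s" "s2 = Suc s3" "s < s3" "s' < s2" | "s' = Suc s" "s2 = Suc s3" "s3 < s" "s2 < s'"
    | "s = Suc s'" "s3 = Suc s2" "s < s3" "s' < s2" | "s = Suc s'" "s3 = Suc s2" "s3 < s" "s2 < s'"
    by fastforce
  then show ?thesis
  proof cases
    case 1
    then have "p = s" "q = s3" using p q s(2-5) by (simp_all add: min_def max_def)
    then show ?thesis using 1 l by auto
  next
    case 2
    then have "p = s3" "q = s" using p q s(2-5) by (simp_all add: min_def max_def)
    then show ?thesis using 2 l' by auto
  next
    case 3
    then have "p = s'" "q = s2" using p q s(2-5) by (simp_all add: min_def max_def)
    then show ?thesis using 3 l by auto
  next
    case 4
    then have "p = s2" "q = s'" using p q s(2-5) by (simp_all add: min_def max_def)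
    then show ?thesis using 4 l' by auto
  qed
qed

lemma hinged_linked:
  assumes "hinged \<Omega> x x'"
  shows "linked x x'"
proof -
  from assms obtain t \<xi> where ch: "chain_in \<Omega> t \<xi>" and ends: "\<xi> 0 = x" "\<xi> t = x'"
    unfolding hinged_def by blast
  define R where "R = {0..t} - {t} - {s. simple_step \<Omega> t \<xi> s}"
  from ch have \<xi>: "\<And>s. s \<le> t \<Longrightarrow> \<xi> s \<in> \<Omega>" unfolding chain_in_def by auto
  have "\<exists>l p q. card R = 2 * l \<and> R = p ` {1..l} \<union> q ` {1..l} \<and>
      (\<forall>m\<in>{1..l}. double_step \<Omega> t \<xi> (p m) (q m)) \<and>
      (\<forall>m\<in>{1..l}. \<forall>n\<in>{1..l}. m < n \<longrightarrow> p m < p n \<and> (q m < p n \<or> q m > q n))"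
    using ch unfolding chain_in_def Let_def R_def[symmetric] by (elim conjE)
  then have "linked (\<xi> 0) (\<xi> t)"
  proof (elim exE conjE)
    fix l :: nat and p q
    assume pq: "R = p ` {1..l} \<union> q ` {1..l}"
      and ds: "\<forall>m\<in>{1..l}. double_step \<Omega> t \<xi> (p m) (q m)"
      and nest: "\<forall>m\<in>{1..l}. \<forall>n\<in>{1..l}. m < n \<longrightarrow> p m < p n \<and> (q m < p n \<or> q m > q n)"
    show "linked (\<xi> 0) (\<xi> t)"
    proof (rule nested_steps_related[of t "\<lambda>u v. linked (\<xi> u) (\<xi> v)" p "{1..l}" q])
      show "linked (\<xi> u) (\<xi> (Suc u)) \<or> u \<in> p ` {1..l} \<union> q ` {1..l}" if "u < t" for u
      proof (cases "simple_step \<Omega> t \<xi> u")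
        case True
        then show ?thesis using simple_step_linked \<xi> by blast
      next
        case False
        with that have "u \<in> R" by (simp add: R_def)
        then show ?thesis unfolding pq by blast
      qed
      \<comment> \<open>The index \<open>t\<close> has been erased, so all listed indices lie below
        \<open>t\<close> and the whole chain is a closed segment.\<close>
      show "p m \<in> {0..<t} \<longleftrightarrow> q m \<in> {0..<t}" if "m \<in> {1..l}" for m
      proof -
        have "p m \<in> R" "q m \<in> R" using that pq by auto
        then show ?thesis unfolding R_def by auto
      qed
      show "p m < q m \<and> (linked (\<xi> (Suc (p m))) (\<xi> (q m)) \<longrightarrow> linked (\<xi> (p m)) (\<xi> (Suc (q m))))"
        if "m \<in> {1..l}" for m
        using double_step_linked ds that by blast
      show "linked (\<xi> u) (\<xi> w)" if "linked (\<xi> u) (\<xi> v)" "linked (\<xi> v) (\<xi> w)" for u v w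
        using that by (rule linked_trans)
      show "linked (\<xi> u) (\<xi> u)" if "u \<le> t" for u
        using \<xi>[OF that] by (rule linked_refl)
      show "p m < p n \<and> (q m < p n \<or> q n < q m)" if "m \<in> {1..l}" "n \<in> {1..l}" "m < n" for m n
        using nest that by blast
    qed simp_all
  qed
  then show ?thesis by (simp add: ends)
qed

end

section \<open>The extension\<close>

locale slice_regular_function_hinged = slice_regular_function +
  assumes hinged: "hinged_domain \<Omega>"
begin

sublocale slice_regular_function_speared
  by unfold_locales (use hinged in \<open>simp add: hinged_domain_def speared_domain_def\<close>)

lemma agree_all:
  assumes "J \<in> imag_units" "slice_map J z \<in> \<Omega>" "J' \<in> imag_units" "slice_map J' z \<in> \<Omega>" "Im z \<ge> 0"
  shows "agree J J' z"
proof -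
  have "slice_map J' z \<in> conj_sphere (slice_map J z) \<inter> \<Omega>"
    using assms by (simp add: conj_sphere_iff upper_coord_slice_map)
  then have "hinged \<Omega> (slice_map J z) (slice_map J' z)"
    using hinged assms(2) unfolding hinged_domain_def by blast
  then show ?thesis using linked_iff[OF assms] hinged_linked by blast
qed

text \<open>The stem comes from a unit \<open>J\<close> whose slice meets the domain over
  \<open>z\<close>, but it is evaluated at the unit \<open>K\<close> of \<open>x\<close>, which may
  be far from \<open>J\<close>. Uniqueness of the value is proved in
  \<open>extension_slice_map\<close>.\<close>

definition extension_value :: "quat \<Rightarrow> quat \<Rightarrow> bool" where
  "extension_value x y \<longleftrightarrow> (\<exists>K J z e a b. K \<in> imag_units \<and> J \<in> imag_units \<and> Im z \<ge> 0 \<and>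
     x = slice_map K z \<and> e > 0 \<and> stem_on (ball J e) (ball z e) a b \<and> y = a z + K * b z)"

definition extension :: "quat \<Rightarrow> quat" where
  "extension x = (THE y. extension_value x y)"

text \<open>All units give the same point over a real \<open>z\<close>, so the difference defining
  \<open>stem_im\<close> vanishes. The value of the extension there is thus independent of the
  unit.\<close>

lemma stem_im_real:
  assumes "stem_on (ball J e) (ball z e) a b" "J \<in> imag_units" "e > 0" "Im z = 0"
  shows "b z = 0"
proof -
  from ex_other_imag_unit[OF assms(2,3)] obtain K where
    K: "K \<in> imag_units" "K \<in> ball J e" "K \<noteq> J" .
  have "b z = stem_im K J z"
    by (rule stem_on_eq(2)[OF assms(1) _ _ K(3)]) (use K assms in auto)
  then show ?thesis using assms(4) by (simp add: stem_im_def slice_map_real)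
qed

text \<open>Hingedness yields a stem valid near both \<open>J\<close> and \<open>J'\<close>; two
  units near each of them identify it with either given stem at \<open>z\<close>.\<close>

lemma stem_on_unique:
  assumes J: "J \<in> imag_units" "e > 0" "stem_on (ball J e) (ball z e) a b"
    and J': "J' \<in> imag_units" "e' > 0" "stem_on (ball J' e') (ball z e') a' b'"
    and z: "Im z \<ge> 0"
  shows "a z = a' z" "b z = b' z"
proof -
  have "slice_map J z \<in> \<Omega>" "slice_map J' z \<in> \<Omega>"
    using stem_onD(1)[OF J(3)] stem_onD(1)[OF J'(3)] J J' by auto
  then have "agree J J' z" using agree_all J(1) J'(1) z by blast
  then obtain d c s where d: "d > 0" "stem_on (ball J d \<union> ball J' d) (ball z d) c s"
    unfolding agree_def by blast
  have *: "c z = a z \<and> s z = b z"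
    if J: "J \<in> imag_units" "e > 0" "stem_on (ball J e) (ball z e) a b"
      and N: "stem_on (ball J d) (ball z d) c s" for J e a b
  proof -
    have "min d e > 0" using that d by simp
    from ex_other_imag_unit[OF J(1) this] obtain K where
      K: "K \<in> imag_units" "K \<in> ball J (min d e)" "K \<noteq> J" .
    show ?thesis
      using stem_on_eq[OF N _ _ K(3), of z] stem_on_eq[OF J(3) _ _ K(3), of z] K J d by simp
  qed
  have "stem_on (ball J d) (ball z d) c s" "stem_on (ball J' d) (ball z d) c s"
    by (rule stem_on_subset[OF d(2)]; auto)+
  with *[OF J] *[OF J'] show "a z = a' z" "b z = b' z" by auto
qed

lemma extension_slice_map:
  assumes K: "K \<in> imag_units" and J: "J \<in> imag_units" "e > 0" "stem_on (ball J e) (ball z e) a b"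
    and z: "Im z \<ge> 0"
  shows "extension (slice_map K z) = a z + K * b z"
  unfolding extension_def
proof (rule the_equality)
  show "extension_value (slice_map K z) (a z + K * b z)"
    unfolding extension_value_def using assms by blast
  fix y assume "extension_value (slice_map K z) y"
  then obtain K' J' z' e' a' b' where
    K': "K' \<in> imag_units" and J': "J' \<in> imag_units" "e' > 0" "stem_on (ball J' e') (ball z' e') a' b'"
    and z': "Im z' \<ge> 0" "slice_map K z = slice_map K' z'" and y: "y = a' z' + K' * b' z'"
    unfolding extension_value_def by blast
  have eq: "z' = z" "Im z = 0 \<or> K = K'"
    using slice_map_eq_upper[OF z'(2) K K' z z'(1)] by auto
  have "a z = a' z" "b z = b' z"
    using stem_on_unique[OF J _ _ _ z] J' unfolding eq(1) by blast+
  \<comment> \<open>If \<open>z\<close> is real, \<open>K'\<close> may differ from \<open>K\<close>,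
    but then \<open>b z\<close> is zero.\<close>
  then show "y = a z + K * b z"
    using stem_im_real[OF J(3,1,2)] eq y by auto
qed

lemma ex_stem_on:
  assumes "J \<in> imag_units" "slice_map J z \<in> \<Omega>" "Im z \<ge> 0"
  shows "\<exists>e>0. \<exists>a b. stem_on (ball J e) (ball z e) a b"
  using agree_refl[OF assms(1,3,2)] by (simp add: agree_def)

lemma extension_eq:
  assumes x: "x \<in> \<Omega>"
  shows "extension x = f x"
proof -
  define z where "z = upper_coord x"
  have z: "Im z \<ge> 0" by (simp add: z_def)
  obtain K where K: "K \<in> imag_units" "x = slice_map K z"
    using ex_slice_map_upper_coord z_def by blast
  with x z obtain e a b where e: "e > 0" "stem_on (ball K e) (ball z e) a b"
    using ex_stem_on[of K z] by blast
  show ?thesis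
    using extension_slice_map[OF K(1) K(1) e z] stem_onD(2)[OF e(2), of K z] K e(1) by simp
qed

section \<open>Regularity of the extension\<close>

lemma extension_has_derivative_upper:
  assumes K: "K \<in> imag_units" and z: "Im z > 0" "slice_map K z \<in> symmetric_completion \<Omega>"
  shows "\<exists>d. ((\<lambda>w. extension (slice_map K w)) has_derivative (\<lambda>w. slice_map K w * d)) (at z)"
proof -
  obtain J where J: "J \<in> imag_units" "slice_map J z \<in> \<Omega>"
    using z K by (auto simp: symmetric_completion_iff upper_coord_slice_map)
  obtain e a b where e: "e > 0" and st: "stem_on (ball J e) (ball z e) a b"
    using ex_stem_on[OF J less_imp_le[OF z(1)]] by blast
  from ex_other_imag_unit[OF J(1) e] obtain L where
    L: "L \<in> imag_units" "L \<in> ball J e" "L \<noteq> J" .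
  \<comment> \<open>Stems describe the extension over the closed upper half plane only; the cut
    keeps the neighbourhood open and inside it.\<close>
  let ?U = "ball z e \<inter> {w. Im w > 0}"
  have U: "open ?U" by (intro open_Int open_ball open_halfspace_Im_gt)
  have "slice_holomorphic_on K (\<lambda>w. stem_re L J w + K * stem_im L J w) ?U"
    by (rule stem_slice_holomorphic[OF L(1) J(1) L(3) K])
      (use stem_onD(1)[OF st] L J(1) e in auto)
  moreover have "stem_re L J w + K * stem_im L J w = extension (slice_map K w)" if w: "w \<in> ?U" for w
  proof -
    obtain e' where e': "e' > 0" "ball w e' \<subseteq> ball z e"
      using w open_contains_ball[of "ball z e"] by blast
    have "stem_on (ball J (min e e')) (ball w (min e e')) a b"
      by (rule stem_on_subset[OF st]) (use e'(2) in auto)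
    then have "extension (slice_map K w) = a w + K * b w"
      using w e e'(1) by (intro extension_slice_map[OF K J(1), of "min e e'"]) auto
    then show ?thesis
      using stem_on_eq[OF st _ _ L(3), of w] L J(1) e w by simp
  qed
  ultimately have "slice_holomorphic_on K (\<lambda>w. extension (slice_map K w)) ?U"
    by (rule slice_holomorphic_on_cong[OF _ U])
  then show ?thesis unfolding slice_holomorphic_on_def using z(1) e by simp
qed

lemma slice_regular_extension: "slice_regular_on extension (symmetric_completion \<Omega>)"
  unfolding slice_regular_on_iff
proof (intro conjI ballI)
  show "open (symmetric_completion \<Omega>)" by (rule open_symmetric_completion[OF open_domain])
  fix K assume K: "K \<in> imag_units"
  show "slice_holomorphic_on K (extension \<circ> slice_map K) (slice_map K -` symmetric_completion \<Omega>)"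
    unfolding slice_holomorphic_on_def comp_def
  proof
    fix z assume "z \<in> slice_map K -` symmetric_completion \<Omega>"
    then have zS: "slice_map K z \<in> symmetric_completion \<Omega>" by simp
    consider "Im z > 0" | "Im z = 0" | "Im z < 0" by linarith
    then show "\<exists>d. ((\<lambda>w. extension (slice_map K w)) has_derivative (\<lambda>w. slice_map K w * d)) (at z)"
    proof cases
      case 1
      then show ?thesis by (rule extension_has_derivative_upper[OF K _ zS])
    next
      case 2
      \<comment> \<open>The sphere of a real point is that point alone, so completion adds no real
        points.\<close>
      then have "slice_map K z \<in> \<Omega>"
        using zS K slice_map_real[OF 2] upper_coord_slice_map[OF K, of z]
        unfolding symmetric_completion_iff by auto
      moreover have "slice_holomorphic_on K (\<lambda>w. extension (slice_map K w)) (slice_map K -` \<Omega>)"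
        by (rule slice_holomorphic_on_cong[OF slice_holomorphic[OF K]
              open_slice_map_vimage[OF open_domain]]) (simp add: extension_eq)
      ultimately show ?thesis unfolding slice_holomorphic_on_def by simp
    next
      case 3
      \<comment> \<open>The lower half of the slice of \<open>K\<close> is the upper half of the
        slice of \<open>- K\<close>, reached by conjugation.\<close>
      have "slice_map (- K) (cnj z) \<in> symmetric_completion \<Omega>"
        using zS by (simp add: slice_map_cnj)
      with extension_has_derivative_upper[of "- K" "cnj z"] 3 K obtain d where
        "((\<lambda>w. extension (slice_map (- K) w)) has_derivative (\<lambda>w. slice_map (- K) w * d)) (at (cnj z))"
        by auto
      from has_derivative_compose[OF bounded_linear_imp_has_derivative[OF bounded_linear_cnj] this]
      show ?thesis by (auto simp: slice_map_cnj)
    qed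
  qed
qed

end

text \<open>Membership in \<open>extensional\<close> fixes the values outside the completion, so
  that uniqueness among total functions means uniqueness as functions on the completion.\<close>

theorem theorem5p12:
  fixes \<Omega> :: "quat set" and f :: "quat \<Rightarrow> quat"
  assumes "hinged_domain \<Omega>"
    and "slice_regular_on f \<Omega>"
  shows "\<exists>!g. g \<in> extensional (symmetric_completion \<Omega>) \<and>
           slice_regular_on g (symmetric_completion \<Omega>) \<and> (\<forall>x\<in>\<Omega>. g x = f x)"
proof -
  interpret slice_regular_function_hinged \<Omega> f
    by unfold_locales (use assms in auto)
  let ?S = "symmetric_completion \<Omega>"
  let ?g = "restrict extension ?S"
  have "slice_regular_on ?g ?S"
    unfolding slice_regular_on_iff
  proof (intro conjI ballI)
    show S: "open ?S" by (rule open_symmetric_completion[OF open_domain])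
    fix I assume "I \<in> imag_units"
    then have "slice_holomorphic_on I (extension \<circ> slice_map I) (slice_map I -` ?S)"
      using slice_regular_extension unfolding slice_regular_on_iff by blast
    then show "slice_holomorphic_on I (?g \<circ> slice_map I) (slice_map I -` ?S)"
      by (rule slice_holomorphic_on_cong[OF _ open_slice_map_vimage[OF S]]) simp
  qed
  moreover have "?g x = f x" if "x \<in> \<Omega>" for x
    using that subset_symmetric_completion[of \<Omega>] by (auto simp: extension_eq)
  moreover have "g = h"
    if "g \<in> extensional ?S" "h \<in> extensional ?S" "slice_regular_on g ?S" "slice_regular_on h ?S"
      "\<forall>x\<in>\<Omega>. g x = f x" "\<forall>x\<in>\<Omega>. h x = f x" for g h
    by (rule extensionalityI[OF that(1,2)]) (rule slice_regular_unique_extension[OF speared that(3,4)],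
        use that(5,6) in simp_all)
  ultimately show ?thesis by (intro ex_ex1I) (auto intro: restrict_extensional)
qed

end
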